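(* Let $n$ and $q$ be integers with $1\le q\le \frac{1}{11}\sqrt{n}$, and let $G$ be a graph on $n$ vertices with $\lambda(G)\ge \lambda(Y_{n,2,q})$. Then $G$ contains at least $q\lfloor n/2\rfloor$ triangles.
   Context: All graphs are finite, simple and undirected. $\lambda(G)$ denotes the spectral radius of $G$, i.e. the largest eigenvalue of its adjacency matrix. $T_{n,2}$ is the bipartite Turán graph, i.e. the complete bipartite graph on $n$ vertices with parts of sizes $\lceil n/2\rceil$ and $\lfloor n/2\rfloor$. $Y_{n,2,q}$ is the graph obtained from $T_{n,2}$ by adding $q$ pairwise disjoint edges (a matching of size $q$) inside the part of size $\lceil n/2\rceil$. *)

theory Defs
  imports "Graph_Theory.Pair_Digraph" "Jordan_Normal_Form.Spectral_Radius"
begin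

text \<open>
  A finite simple undirected graph is a \<^locale>\<open>pair_graph\<close>: a finite vertex set \<^term>\<open>pverts G\<close>
  with a symmetric irreflexive relation \<^term>\<open>parcs G\<close>, in which an edge between \<open>u\<close> and \<open>v\<close>
  is the pair of arcs \<open>(u, v)\<close> and \<open>(v, u)\<close>.
\<close>

text \<open>Matrices are indexed by numbers, so the vertices are listed as \<open>f 0, f 1, \<dots>\<close>.\<close>

definition adjacency_matrix :: "'a pair_pre_digraph \<Rightarrow> (nat \<Rightarrow> 'a) \<Rightarrow> real mat" where
  "adjacency_matrix G f =
     mat (card (pverts G)) (card (pverts G)) (\<lambda>(i, j). if (f i, f j) \<in> parcs G then 1 else 0)"

definition vertex_enum :: "'a pair_pre_digraph \<Rightarrow> nat \<Rightarrow> 'a" where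
  "vertex_enum G = (SOME f. bij_betw f {..<card (pverts G)} (pverts G))"

text \<open>
  The largest eigenvalue over the reals; the adjacency matrix is symmetric, so no eigenvalue is
  lost. The value is meaningful only for a nonempty vertex set.
\<close>

definition graph_spectral_radius :: "'a pair_pre_digraph \<Rightarrow> real" where
  "graph_spectral_radius G = Max (spectrum (adjacency_matrix G (vertex_enum G)))"

definition triangles :: "'a pair_pre_digraph \<Rightarrow> 'a set set" where
  "triangles G = {T. T \<subseteq> pverts G \<and> card T = 3 \<and> (\<forall>u\<in>T. \<forall>v\<in>T. u \<noteq> v \<longrightarrow> (u, v) \<in> parcs G)}"

text \<open>
  The part of size \<open>\<lceil>n/2\<rceil>\<close> is \<open>{..<(n + 1) div 2}\<close>, and the added matching consists of the edges
  \<open>{0,1}, {2,3}, \<dots>, {2q-2, 2q-1}\<close>, which lie in that part when \<open>2 * q \<le> (n + 1) div 2\<close>;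
  otherwise no such matching exists and \<open>Y_graph n q\<close> has no meaning.
\<close>

definition turan_bipartite :: "nat \<Rightarrow> nat pair_pre_digraph" where
  "turan_bipartite n = \<lparr>pverts = {..<n},
     parcs = {..<(n + 1) div 2} \<times> {(n + 1) div 2..<n} \<union> {(n + 1) div 2..<n} \<times> {..<(n + 1) div 2}\<rparr>"

definition Y_graph :: "nat \<Rightarrow> nat \<Rightarrow> nat pair_pre_digraph" where
  "Y_graph n q = \<lparr>pverts = pverts (turan_bipartite n),
     parcs = parcs (turan_bipartite n) \<union> (\<Union>i<q. {(2 * i, 2 * i + 1), (2 * i + 1, 2 * i)})\<rparr>"

lemma pair_graph_Y_graph:
  assumes "2 * q \<le> (n + 1) div 2"
  shows "pair_graph (Y_graph n q)"
proof
  fix e assume "e \<in> parcs (Y_graph n q)"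
  then show "fst e \<in> pverts (Y_graph n q)" "snd e \<in> pverts (Y_graph n q)" "fst e \<noteq> snd e"
    using assms by (auto simp: Y_graph_def turan_bipartite_def)
next
  show "symmetric (with_proj (Y_graph n q))"
    unfolding symmetric_def with_proj_simps
    by (rule symI) (auto simp: Y_graph_def turan_bipartite_def)
qed (auto simp: Y_graph_def turan_bipartite_def)

lemma bij_betw_vertex_enum:
  assumes "finite (pverts G)"
  shows "bij_betw (vertex_enum G) {..<card (pverts G)} (pverts G)"
  unfolding vertex_enum_def lessThan_atLeast0
  by (rule someI_ex[OF ex_bij_betw_nat_finite[OF assms]])

text \<open>The spectrum does not depend on the enumeration of the vertices.\<close>

lemma eigenvalue_adjacency_matrix_iff:
  assumes f: "bij_betw f {..<card (pverts G)} (pverts G)"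
  shows "eigenvalue (adjacency_matrix G f) k \<longleftrightarrow>
    (\<exists>x. (\<exists>v\<in>pverts G. x v \<noteq> 0) \<and>
      (\<forall>v\<in>pverts G. (\<Sum>w\<in>pverts G. (if (v, w) \<in> parcs G then 1 else 0) * x w) = k * x v))"
    (is "?L \<longleftrightarrow> ?R")
proof -
  let ?n = "card (pverts G)" and ?A = "adjacency_matrix G f"
  let ?a = "\<lambda>v w. if (v, w) \<in> parcs G then 1 else (0::real)"
  have inj: "inj_on f {..<?n}" using f by (rule bij_betw_imp_inj_on)
  have f_in: "f i \<in> pverts G" if "i < ?n" for i
    by (rule bij_betwE[OF f, rule_format]) (use that in simp)
  have f_ex: "\<exists>i<?n. v = f i" if "v \<in> pverts G" for v
    using that f unfolding bij_betw_def by blast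
  have mult: "(?A *\<^sub>v y) $ i = (\<Sum>w\<in>pverts G. ?a (f i) w * x w)"
    if "y \<in> carrier_vec ?n" "i < ?n" "\<And>j. j < ?n \<Longrightarrow> y $ j = x (f j)" for x y i
  proof -
    have "(?A *\<^sub>v y) $ i = (\<Sum>j<?n. ?a (f i) (f j) * x (f j))"
      using that by (simp add: adjacency_matrix_def scalar_prod_def lessThan_atLeast0)
    also have "\<dots> = (\<Sum>w\<in>pverts G. ?a (f i) w * x w)"
      by (rule sum.reindex_bij_betw[OF f])
    finally show ?thesis .
  qed
  have dim: "dim_row ?A = ?n" "dim_col ?A = ?n" by (auto simp: adjacency_matrix_def)
  show ?thesis
  proof
    assume ?L
    then obtain y where y: "y \<in> carrier_vec ?n" "y \<noteq> 0\<^sub>v ?n" "?A *\<^sub>v y = k \<cdot>\<^sub>v y"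
      unfolding eigenvalue_def eigenvector_def dim by blast
    define x where "x v = y $ the_inv_into {..<?n} f v" for v
    have xf: "y $ j = x (f j)" if "j < ?n" for j
      using that inj by (simp add: x_def the_inv_into_f_f)
    have "\<not> (\<forall>i<?n. y $ i = 0)"
    proof
      assume "\<forall>i<?n. y $ i = 0"
      then have "y = 0\<^sub>v ?n" using carrier_vecD[OF y(1)] by (intro eq_vecI) simp_all
      with y(2) show False ..
    qed
    then obtain i where "i < ?n" "y $ i \<noteq> 0" by blast
    then have nz: "\<exists>v\<in>pverts G. x v \<noteq> 0" using xf f_in by (intro bexI[of _ "f i"]) simp_all
    have *: "(\<Sum>w\<in>pverts G. ?a (f j) w * x w) = k * x (f j)" if "j < ?n" for j
      using mult[OF y(1) that xf] y(1,3) xf[OF that] that by simp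
    have all: "\<forall>v\<in>pverts G. (\<Sum>w\<in>pverts G. ?a v w * x w) = k * x v"
    proof
      fix v assume "v \<in> pverts G"
      then obtain j where "j < ?n" "v = f j" using f_ex by blast
      then show "(\<Sum>w\<in>pverts G. ?a v w * x w) = k * x v" using * by simp
    qed
    show ?R using nz all by (intro exI[of _ x] conjI)
  next
    assume ?R
    then obtain x where x: "\<exists>v\<in>pverts G. x v \<noteq> 0"
      "\<And>v. v \<in> pverts G \<Longrightarrow> (\<Sum>w\<in>pverts G. ?a v w * x w) = k * x v" by blast
    let ?y = "vec ?n (\<lambda>j. x (f j))"
    obtain v where "v \<in> pverts G" "x v \<noteq> 0" using x(1) by blast
    moreover from this(1) obtain i where "i < ?n" "v = f i" using f_ex by blast
    ultimately have i: "i < ?n" "x (f i) \<noteq> 0" by simp_all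
    have "?y \<noteq> 0\<^sub>v ?n"
    proof
      assume "?y = 0\<^sub>v ?n"
      then have "?y $ i = 0\<^sub>v ?n $ i" by (rule arg_cong)
      with i show False by simp
    qed
    moreover have "?A *\<^sub>v ?y = k \<cdot>\<^sub>v ?y"
    proof (rule eq_vecI)
      fix i assume "i < dim_vec (k \<cdot>\<^sub>v ?y)"
      then have i: "i < ?n" by simp
      then have "f i \<in> pverts G" by (rule f_in)
      then show "(?A *\<^sub>v ?y) $ i = (k \<cdot>\<^sub>v ?y) $ i" using mult[of ?y i x] i x(2) by simp
    qed (simp add: dim)
    ultimately show ?L unfolding eigenvalue_def eigenvector_def dim
      by (intro exI[of _ ?y] conjI) simp_all
  qed
qed

lemma graph_spectral_radius_eq:
  assumes "finite (pverts G)" and "bij_betw f {..<card (pverts G)} (pverts G)"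
  shows "graph_spectral_radius G = Max (spectrum (adjacency_matrix G f))"
proof -
  have "eigenvalue (adjacency_matrix G (vertex_enum G)) k \<longleftrightarrow> eigenvalue (adjacency_matrix G f) k" for k
    by (rule trans[OF eigenvalue_adjacency_matrix_iff[OF bij_betw_vertex_enum[OF assms(1)]]
          eigenvalue_adjacency_matrix_iff[OF assms(2), symmetric]])
  then have "eigenvalue (adjacency_matrix G (vertex_enum G)) = eigenvalue (adjacency_matrix G f)"
    by (rule ext)
  then show ?thesis by (simp only: graph_spectral_radius_def spectrum_def)
qed

end

theory Submission
  imports Defs "HOL-Analysis.Function_Topology" "HOL-Analysis.Convex"
    "HOL-Combinatorics.Multiset_Permutations"
begin

text \<open>
  Write \<open>a = \<lceil>n/2\<rceil>\<close>, \<open>b = \<lfloor>n/2\<rfloor>\<close> and \<open>N = sqrt (a b)\<close>, and let \<open>r\<close> be the spectral radius of \<open>G\<close>,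
  with nonnegative unit eigenvector \<open>x\<close>. A test vector that is constant on each part of the
  Turan graph gives \<open>N + q/a \<le> r\<close> (\<open>spectral_radius_Y_graph_ge\<close>). Suppose that \<open>G\<close> has
  \<open>t < q b\<close> triangles. The contradiction comes from a direct upper bound on \<open>r\<close>.

  The inequality \<open>t \<ge> r (r^2 - m) / 3\<close> for the number \<open>m\<close> of edges (\<open>trace_cube_bound\<close>) shows
  \<open>m \<ge> a b - q\<close>. Averaging over the bipartitions of the vertex set into a neighbourhood and its
  complement shows that one of them has at most \<open>4 q\<close> edges inside its two parts (\<open>ex_neighbourhood_bipartition\<close>).
  Fix one; let \<open>s\<close> be the number of inside edges, and let \<open>R\<close> be \<open>a b\<close> minus the number of
  crossing edges. Then \<open>G\<close> is so close to a balanced complete bipartite graph that \<open>x\<close> is almost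
  constant: its weight is split nearly evenly over the two parts (\<open>weight_balance\<close>), and its largest
  entry \<open>\<beta>\<close> satisfies \<open>2 N \<beta>^2 \<le> 1 + 20 q / N\<close> (\<open>entry_bound\<close>).

  In the quadratic form of \<open>x\<close> the crossing edges contribute at most \<open>sqrt (a b - R)\<close> by the
  Cauchy-Schwarz inequality and the inside edges at most \<open>2 s \<beta>^2\<close>. Comparing with \<open>N + q/a\<close> yields
  \<open>2 q + R \<le> 2 s + (error)\<close>, where the error is below \<open>1\<close> unless \<open>s > q\<close>
  (\<open>edge_deficit_bound\<close>). On the other hand both ends of an inside edge are adjacent to all but
  a few vertices of the opposite part, so that \<open>t \<ge> s (b - R)\<close> (\<open>triples_ge_inside\<close>). With
  \<open>t < q b\<close> the two inequalities are contradictory: \<open>s < q\<close> violates the first; \<open>s = q\<close> forces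
  \<open>R = 0\<close> and hence \<open>t \<ge> q b\<close>; and if \<open>s > q\<close>, then the second one requires a larger \<open>R\<close>
  than the first one allows (\<open>deficit_contradiction\<close>).

  All counts are kept as sums over ordered pairs and triples of vertices: \<open>degree_sum\<close> is \<open>2 m\<close>,
  \<open>triples\<close> is \<open>6 t\<close>, and \<open>inside X\<close> is \<open>2 s\<close>.
\<close>

section \<open>The quadratic form of a graph and its Perron vector\<close>

locale adjacency_function =
  fixes V :: "'v set" and adj :: "'v \<Rightarrow> 'v \<Rightarrow> real"
  assumes finite_V: "finite V" and V_nonempty: "V \<noteq> {}"
    and adj_01: "adj u v = 0 \<or> adj u v = 1"
    and adj_sym: "adj u v = adj v u"
    and adj_irrefl: "adj u u = 0"
begin

definition quad :: "('v \<Rightarrow> real) \<Rightarrow> real" where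
  "quad z = (\<Sum>u\<in>V. \<Sum>v\<in>V. adj u v * z u * z v)"

definition perron_pair :: "real \<Rightarrow> ('v \<Rightarrow> real) \<Rightarrow> bool" where
  "perron_pair r x \<longleftrightarrow> (\<forall>v. 0 \<le> x v) \<and> (\<Sum>v\<in>V. (x v)\<^sup>2) = 1 \<and>
     (\<forall>v\<in>V. (\<Sum>w\<in>V. adj v w * x w) = r * x v) \<and>
     (\<forall>z. quad z \<le> r * (\<Sum>v\<in>V. (z v)\<^sup>2))"

lemma adj_nonneg: "0 \<le> adj u v" and adj_le_1: "adj u v \<le> 1" and adj_square: "(adj u v)\<^sup>2 = adj u v"
  using adj_01[of u v] by auto

lemma quad_cong: "(\<And>v. v \<in> V \<Longrightarrow> z v = z' v) \<Longrightarrow> quad z = quad z'"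
  unfolding quad_def by (intro sum.cong) auto

lemma quad_le_abs: "quad z \<le> quad (\<lambda>v. \<bar>z v\<bar>)" and quad_ge_abs: "- quad (\<lambda>v. \<bar>z v\<bar>) \<le> quad z"
proof -
  have *: "\<bar>adj u v * z u * z v\<bar> = adj u v * \<bar>z u\<bar> * \<bar>z v\<bar>" for u v
    using adj_nonneg[of u v] by (simp add: abs_mult)
  have "\<bar>quad z\<bar> \<le> (\<Sum>u\<in>V. \<Sum>v\<in>V. \<bar>adj u v * z u * z v\<bar>)"
    unfolding quad_def by (intro order_trans[OF sum_abs] sum_mono sum_abs)
  then have "\<bar>quad z\<bar> \<le> quad (\<lambda>v. \<bar>z v\<bar>)" unfolding * quad_def .
  then show "quad z \<le> quad (\<lambda>v. \<bar>z v\<bar>)" "- quad (\<lambda>v. \<bar>z v\<bar>) \<le> quad z" by auto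
qed

lemma quad_add_scale:
  "quad (\<lambda>v. x v + t * z v) = quad x + 2 * t * (\<Sum>u\<in>V. z u * (\<Sum>v\<in>V. adj u v * x v)) + t\<^sup>2 * quad z"
proof -
  have sw: "(\<Sum>u\<in>V. \<Sum>v\<in>V. adj u v * x u * z v) = (\<Sum>u\<in>V. \<Sum>v\<in>V. adj u v * z u * x v)"
    by (subst sum.swap) (simp add: adj_sym mult_ac)
  have "quad (\<lambda>v. x v + t * z v) = quad x + t * (\<Sum>u\<in>V. \<Sum>v\<in>V. adj u v * x u * z v)
     + t * (\<Sum>u\<in>V. \<Sum>v\<in>V. adj u v * z u * x v) + t\<^sup>2 * quad z"
    unfolding quad_def by (simp add: algebra_simps power2_eq_square sum.distrib sum_distrib_left)
  then show ?thesis unfolding sw by (simp add: sum_distrib_left algebra_simps)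
qed

lemma quad_scale: "quad (\<lambda>v. t * z v) = t\<^sup>2 * quad z"
  using quad_add_scale[of "\<lambda>_. 0" t z] by (simp add: quad_def)

lemma perron_pair_quad:
  assumes "perron_pair r x"
  shows "quad x = r"
proof -
  have x1: "(\<Sum>v\<in>V. (x v)\<^sup>2) = 1" and eig: "\<And>v. v \<in> V \<Longrightarrow> (\<Sum>w\<in>V. adj v w * x w) = r * x v"
    using assms unfolding perron_pair_def by blast+
  have "quad x = (\<Sum>u\<in>V. x u * (\<Sum>v\<in>V. adj u v * x v))"
    by (simp add: quad_def sum_distrib_left mult_ac)
  also have "\<dots> = r"
    using eig x1 by (simp add: power2_eq_square mult.left_commute flip: sum_distrib_left)
  finally show ?thesis .
qed

text \<open>
  The quadratic form attains its maximum \<open>r\<close> on the unit sphere, which is compact in the product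
  topology once all entries off \<open>V\<close> are fixed to \<open>0\<close>. Passing to absolute values does not decrease
  the form, as the weights are nonnegative, so a maximiser \<open>x\<close> can be taken nonnegative. Moving \<open>x\<close>
  in a coordinate direction cannot raise \<open>quad\<close> above \<open>r\<close> times the squared norm, and vanishing of
  the first-order term is the eigenvector equation.
\<close>

lemma ex_perron_pair: "\<exists>r x. perron_pair r x"
proof -
  define S where "S = {z. (\<forall>v. z v \<in> (if v \<in> V then {-1..1} else {0::real})) \<and> (\<Sum>v\<in>V. (z v)\<^sup>2) = 1}"
  have "compactin (product_topology (\<lambda>_. euclidean) UNIV)
      (PiE UNIV (\<lambda>v. if v \<in> V then {-1..1} else {0::real}))"
    unfolding compactin_PiE by auto
  then have comp0: "compact (PiE UNIV (\<lambda>v. if v \<in> V then {-1..1} else {0::real}))"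
    by (simp add: euclidean_product_topology)
  have "closed {z :: 'v \<Rightarrow> real. (\<Sum>v\<in>V. (z v)\<^sup>2) = 1}"
    by (intro closed_Collect_eq continuous_intros) (auto intro: continuous_on_product_coordinates)
  from compact_Int_closed[OF comp0 this] have comp: "compact S"
    unfolding S_def by (simp add: PiE_UNIV_domain Int_def Pi_iff)
  obtain v0 where v0: "v0 \<in> V" using V_nonempty by blast
  have "(\<lambda>v. if v = v0 then 1 else 0) \<in> S"
    using v0 finite_V by (auto simp: S_def if_distrib[of "\<lambda>t. t\<^sup>2"] cong: if_cong)
  then have ne: "S \<noteq> {}" by blast
  have "continuous_on S quad"
    unfolding quad_def[abs_def] by (intro continuous_intros) (auto intro: continuous_on_subset[OF continuous_on_product_coordinates])
  from continuous_attains_sup[OF comp ne this]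
  obtain y where y: "y \<in> S" "\<And>z. z \<in> S \<Longrightarrow> quad z \<le> quad y" by blast
  define r where "r = quad y"
  have rayleigh: "quad z \<le> r * (\<Sum>v\<in>V. (z v)\<^sup>2)" for z
  proof (cases "(\<Sum>v\<in>V. (z v)\<^sup>2) = 0")
    case True
    then have "\<And>v. v \<in> V \<Longrightarrow> z v = 0" using finite_V by (simp add: sum_nonneg_eq_0_iff)
    then have "quad z = 0" by (simp add: quad_def)
    with True show ?thesis by simp
  next
    case False
    define s where "s = (\<Sum>v\<in>V. (z v)\<^sup>2)"
    have s: "s > 0" using False sum_nonneg[of V "\<lambda>v. (z v)\<^sup>2"] unfolding s_def by auto
    define z' where "z' v = (if v \<in> V then (1 / sqrt s) * z v else 0)" for v
    have sq: "(\<Sum>v\<in>V. (z' v)\<^sup>2) = 1"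
      using s by (simp add: z'_def power_mult_distrib power_divide flip: sum_divide_distrib s_def)
    have "\<bar>z' v\<bar> \<le> 1" if "v \<in> V" for v
    proof -
      have "(z' v)\<^sup>2 \<le> 1" unfolding sq[symmetric]
        using that finite_V by (intro member_le_sum) auto
      then show ?thesis by (simp add: abs_square_le_1)
    qed
    then have "\<forall>v. z' v \<in> (if v \<in> V then {-1..1} else {0})"
      by (auto simp: abs_le_iff minus_le_iff) (simp add: z'_def)
    then have "z' \<in> S" using sq unfolding S_def by blast
    then have "quad z' \<le> r" using y(2) r_def by blast
    moreover have "quad z' = quad (\<lambda>v. (1 / sqrt s) * z v)"
      by (rule quad_cong) (simp add: z'_def)
    ultimately have "(1 / sqrt s)\<^sup>2 * quad z \<le> r" unfolding quad_scale by simp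
    then show ?thesis using s unfolding s_def[symmetric] by (simp add: power_divide field_simps)
  qed
  define x where "x v = \<bar>y v\<bar>" for v
  have x1: "(\<Sum>v\<in>V. (x v)\<^sup>2) = 1" using y(1) by (simp add: x_def S_def)
  have xr: "quad x = r"
    using quad_le_abs[of y] rayleigh[of x] unfolding x1 unfolding x_def[abs_def] r_def by simp
  have eig: "(\<Sum>w\<in>V. adj v w * x w) = r * x v" if v: "v \<in> V" for v
  proof (rule ccontr)
    define e where "e u = (if u = v then 1 else 0 :: real)" for u
    define d where "d = r * x v - (\<Sum>w\<in>V. adj v w * x w)"
    assume "(\<Sum>w\<in>V. adj v w * x w) \<noteq> r * x v"
    then have d: "d \<noteq> 0" by (simp add: d_def)
    have qe: "quad e = 0"
      using finite_V v unfolding quad_def e_def by (simp add: adj_irrefl if_distrib if_distribR cong: if_cong)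
    have e1: "(\<Sum>u\<in>V. e u * (\<Sum>w\<in>V. adj u w * x w)) = (\<Sum>w\<in>V. adj v w * x w)"
      using finite_V v unfolding e_def by (simp add: if_distrib if_distribR cong: if_cong)
    have *: "0 \<le> 2 * t * d + t\<^sup>2 * r" for t
    proof -
      have "(\<Sum>u\<in>V. (x u + t * e u)\<^sup>2) = (\<Sum>u\<in>V. (x u)\<^sup>2 + (if u = v then 2 * t * x u + t\<^sup>2 else 0))"
        by (intro sum.cong) (auto simp: e_def power2_sum)
      also have "\<dots> = 1 + 2 * t * x v + t\<^sup>2"
        using finite_V v x1 by (simp add: sum.distrib)
      finally show ?thesis
        using rayleigh[of "\<lambda>u. x u + t * e u"] unfolding quad_add_scale xr e1 qe d_def
        by (simp add: algebra_simps)
    qed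
    \<comment> \<open>This step size makes the first-order term beat the second-order one.\<close>
    define e' where "e' = d / (\<bar>r\<bar> + 1)"
    have "\<bar>r\<bar> + 1 \<noteq> 0" by linarith
    then have d_eq: "d = e' * (\<bar>r\<bar> + 1)" by (simp add: e'_def)
    have "0 \<le> 2 * (- e') * d + (- e')\<^sup>2 * r" by (rule *)
    also have "\<dots> = e'\<^sup>2 * (r - 2 * (\<bar>r\<bar> + 1))"
      by (simp add: d_eq algebra_simps power2_eq_square)
    also have "\<dots> < 0"
      using d d_eq by (intro mult_pos_neg) auto
    finally show False by simp
  qed
  have "perron_pair r x" unfolding perron_pair_def using x1 eig rayleigh by (auto simp: x_def)
  then show ?thesis by blast
qed

section \<open>Triangles, edges and bipartitions\<close>

definition degree :: "'v \<Rightarrow> real" where "degree u = (\<Sum>v\<in>V. adj u v)"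
definition degree_sum :: real where "degree_sum = (\<Sum>u\<in>V. degree u)"
definition triples :: real where
  "triples = (\<Sum>u\<in>V. \<Sum>v\<in>V. \<Sum>w\<in>V. adj u v * adj u w * adj v w)"
text \<open>
  Sums run over ordered pairs, so \<open>inside X\<close> counts each edge within \<open>X\<close> or within its complement
  twice, while \<open>cross X\<close> counts each edge between the two parts once.
\<close>

definition inside :: "'v set \<Rightarrow> real" where
  "inside X = (\<Sum>u\<in>V. \<Sum>v\<in>V. if u \<in> X \<longleftrightarrow> v \<in> X then adj u v else 0)"
definition cross :: "'v set \<Rightarrow> real" where
  "cross X = (\<Sum>u\<in>X. \<Sum>v\<in>V - X. adj u v)"

text \<open>
  With \<open>R = A - r x x\<^sup>T\<close> for the adjacency matrix \<open>A\<close>, the trace of \<open>R A R\<close> is \<open>triples - r ^ 3\<close>,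
  and the squared Frobenius norm of \<open>R\<close> is \<open>degree_sum - r\<^sup>2\<close>. Every vector \<open>z\<close> satisfies
  \<open>quad z \<ge> - r \<bar>z\<bar>\<^sup>2\<close>, since replacing \<open>z\<close> by its absolute values bounds \<open>\<bar>quad z\<bar>\<close>.
  Applying this to the rows of \<open>R\<close> and adding up gives the claim, which
  bounds the number of triangles below in terms of the number of edges.
\<close>

lemma trace_cube_bound:
  assumes "perron_pair r x"
  shows "2 * r ^ 3 \<le> triples + r * degree_sum"
proof -
  have x1: "(\<Sum>v\<in>V. (x v)\<^sup>2) = 1"
    and eig: "\<And>v. v \<in> V \<Longrightarrow> (\<Sum>w\<in>V. adj v w * x w) = r * x v"
    and ray: "\<And>z. quad z \<le> r * (\<Sum>v\<in>V. (z v)\<^sup>2)"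
    using assms unfolding perron_pair_def by blast+
  have quadx: "quad x = r" by (rule perron_pair_quad[OF assms])
  have lower: "- (r * (\<Sum>v\<in>V. (z v)\<^sup>2)) \<le> quad z" for z
    using ray[of "\<lambda>v. \<bar>z v\<bar>"] quad_ge_abs[of z] by simp
  have row: "(\<Sum>u\<in>V. \<Sum>v\<in>V. adj i u * adj i v * adj u v) - r ^ 3 * (x i)\<^sup>2
      \<ge> - (r * (degree i - r\<^sup>2 * (x i)\<^sup>2))" if i: "i \<in> V" for i
  proof -
    \<comment> \<open>Row \<open>i\<close> of \<open>R\<close> is \<open>\<lambda>v. adj i v + c * x v\<close>.\<close>
    define c where "c = - (r * x i)"
    have "(\<Sum>v\<in>V. (adj i v + c * x v)\<^sup>2)
        = (\<Sum>v\<in>V. (adj i v)\<^sup>2) + 2 * c * (\<Sum>v\<in>V. adj i v * x v) + c\<^sup>2 * (\<Sum>v\<in>V. (x v)\<^sup>2)"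
      by (simp add: power2_sum power_mult_distrib sum.distrib sum_distrib_left algebra_simps)
    then have n: "(\<Sum>v\<in>V. (adj i v + c * x v)\<^sup>2) = degree i - r\<^sup>2 * (x i)\<^sup>2"
      unfolding eig[OF i] x1 adj_square by (simp add: degree_def c_def power2_eq_square algebra_simps)
    have "(\<Sum>u\<in>V. x u * (\<Sum>v\<in>V. adj u v * adj i v)) = (\<Sum>v\<in>V. adj i v * (\<Sum>u\<in>V. adj v u * x u))"
      unfolding sum_distrib_left by (subst sum.swap) (simp add: adj_sym mult_ac)
    also have "\<dots> = (\<Sum>v\<in>V. r * (adj i v * x v))"
      by (intro sum.cong refl) (simp add: eig)
    also have "\<dots> = r * (r * x i)" unfolding eig[OF i, symmetric] by (simp add: sum_distrib_left)
    finally have "quad (\<lambda>v. adj i v + c * x v) = quad (adj i) - r ^ 3 * (x i)\<^sup>2"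
      unfolding quad_add_scale quadx by (simp add: c_def power2_eq_square power3_eq_cube algebra_simps)
    with lower[of "\<lambda>v. adj i v + c * x v"] n show ?thesis
      by (simp add: quad_def mult_ac)
  qed
  have "(\<Sum>i\<in>V. - (r * (degree i - r\<^sup>2 * (x i)\<^sup>2)))
      \<le> (\<Sum>i\<in>V. (\<Sum>u\<in>V. \<Sum>v\<in>V. adj i u * adj i v * adj u v) - r ^ 3 * (x i)\<^sup>2)"
    by (intro sum_mono row)
  also have "\<dots> = triples - r ^ 3"
    unfolding sum_subtractf triples_def by (simp add: x1 flip: sum_distrib_left)
  also have "(\<Sum>i\<in>V. - (r * (degree i - r\<^sup>2 * (x i)\<^sup>2))) = - (r * (degree_sum - r\<^sup>2))"
    unfolding degree_sum_def by (simp add: sum_negf sum_subtractf x1 flip: sum_distrib_left)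
  finally show ?thesis by (simp add: power2_eq_square power3_eq_cube algebra_simps)
qed

text \<open>
  Take for \<open>X\<close> the neighbourhood of a vertex \<open>v\<close> and average over \<open>v\<close>. Summed over \<open>v\<close>, the
  inside pairs are all \<open>card V * degree_sum\<close> pairs minus those split by the neighbourhood, and
  inclusion-exclusion expresses the latter by the sum of the squared degrees and the triangles.
  If the edge number is near \<open>card V ^ 2 / 4\<close> and there are few triangles, the resulting bound is small.
\<close>

lemma ex_neighbourhood_bipartition:
  "\<exists>X\<subseteq>V. card V * inside X \<le> card V * degree_sum - 2 * degree_sum\<^sup>2 / card V + 2 * triples"
proof -
  define N where "N v = {u\<in>V. adj v u = 1}" for v
  have ind: "(if u \<in> N v \<longleftrightarrow> w \<in> N v then adj u w else 0)
      = adj u w - adj u v * adj u w - adj w v * adj w u + 2 * (adj v u * adj v w * adj u w)"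
    if "u \<in> V" "w \<in> V" for u v w
    using adj_01[of v u] adj_01[of v w] that adj_sym[of v u] adj_sym[of v w] adj_sym[of w u]
    by (auto simp: N_def)
  have deg2: "(\<Sum>v\<in>V. \<Sum>u\<in>V. \<Sum>w\<in>V. adj u v * adj u w) = (\<Sum>u\<in>V. (degree u)\<^sup>2)"
    by (subst sum.swap) (simp add: degree_def power2_eq_square sum_product)
  have deg2': "(\<Sum>v\<in>V. \<Sum>u\<in>V. \<Sum>w\<in>V. adj w v * adj w u) = (\<Sum>u\<in>V. (degree u)\<^sup>2)"
    unfolding deg2[symmetric] by (rule sum.cong[OF refl], rule sum.swap)
  have "(\<Sum>v\<in>V. inside (N v)) = (\<Sum>v\<in>V. \<Sum>u\<in>V. \<Sum>w\<in>V.
      adj u w - adj u v * adj u w - adj w v * adj w u + 2 * (adj v u * adj v w * adj u w))"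
    unfolding inside_def by (intro sum.cong refl ind)
  also have "\<dots> = card V * degree_sum - 2 * (\<Sum>u\<in>V. (degree u)\<^sup>2) + 2 * triples"
    unfolding sum.distrib sum_subtractf deg2 deg2'
    by (simp add: triples_def degree_sum_def degree_def sum_distrib_left sum_negf)
  finally have total: "(\<Sum>v\<in>V. inside (N v))
      = card V * degree_sum - 2 * (\<Sum>u\<in>V. (degree u)\<^sup>2) + 2 * triples" .
  have cV: "0 < card V" using finite_V V_nonempty by (simp add: card_gt_0_iff)
  have "degree_sum\<^sup>2 / card V \<le> (\<Sum>u\<in>V. (degree u)\<^sup>2)"
    using sum_squared_le_sum_of_squares[of degree V] cV unfolding degree_sum_def
    by (simp add: divide_le_eq)
  then have le: "(\<Sum>v\<in>V. inside (N v))
      \<le> card V * degree_sum - 2 * degree_sum\<^sup>2 / card V + 2 * triples" (is "_ \<le> ?B")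
    unfolding total by simp
  have "\<exists>v\<in>V. card V * inside (N v) \<le> ?B"
  proof (rule ccontr)
    assume "\<not> ?thesis"
    then have "(\<Sum>v\<in>V. ?B) < (\<Sum>v\<in>V. card V * inside (N v))"
      by (intro sum_strict_mono finite_V V_nonempty) (auto simp: not_le)
    then have "card V * ?B < card V * (\<Sum>v\<in>V. inside (N v))"
      by (simp flip: sum_distrib_left)
    with le cV show False by simp
  qed
  then obtain v where "v \<in> V" "card V * inside (N v) \<le> ?B" by blast
  moreover have "N v \<subseteq> V" by (auto simp: N_def)
  ultimately show ?thesis by blast
qed

lemma inside_eq:
  assumes "X \<subseteq> V"
  shows "inside X = (\<Sum>u\<in>X. \<Sum>v\<in>X. adj u v) + (\<Sum>u\<in>V-X. \<Sum>v\<in>V-X. adj u v)"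
proof -
  have spl: "sum f V = sum f X + sum f (V - X)" for f :: "'v \<Rightarrow> real"
    using sum.subset_diff[OF assms finite_V, of f] by simp
  have "(\<Sum>u\<in>X. \<Sum>v\<in>V. if u \<in> X \<longleftrightarrow> v \<in> X then adj u v else 0) = (\<Sum>u\<in>X. \<Sum>v\<in>X. adj u v)"
    by (rule sum.cong[OF refl]) (simp add: spl)
  moreover have "(\<Sum>u\<in>V-X. \<Sum>v\<in>V. if u \<in> X \<longleftrightarrow> v \<in> X then adj u v else 0) = (\<Sum>u\<in>V-X. \<Sum>v\<in>V-X. adj u v)"
    by (rule sum.cong[OF refl]) (simp add: spl)
  ultimately show ?thesis unfolding inside_def by (subst spl) simp
qed

lemma cross_compl:
  assumes "X \<subseteq> V"
  shows "cross (V - X) = cross X"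
proof -
  have "V - (V - X) = X" using assms by blast
  then show ?thesis unfolding cross_def by (subst sum.swap) (simp add: adj_sym)
qed

lemma sum_pairs_bipartition:
  fixes g :: "'v \<Rightarrow> 'v \<Rightarrow> real"
  assumes "X \<subseteq> V" and "\<And>u v. g u v = g v u"
  shows "(\<Sum>u\<in>V. \<Sum>v\<in>V. g u v) = (\<Sum>u\<in>X. \<Sum>v\<in>X. g u v) + (\<Sum>u\<in>V-X. \<Sum>v\<in>V-X. g u v)
     + 2 * (\<Sum>u\<in>X. \<Sum>v\<in>V-X. g u v)"
proof -
  have spl: "sum f V = sum f X + sum f (V - X)" for f :: "'v \<Rightarrow> real"
    using sum.subset_diff[OF assms(1) finite_V, of f] by simp
  have "(\<Sum>u\<in>V-X. \<Sum>v\<in>X. g u v) = (\<Sum>u\<in>X. \<Sum>v\<in>V-X. g u v)"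
    by (subst sum.swap) (simp add: assms(2))
  then show ?thesis by (simp add: spl sum.distrib)
qed

lemma degree_sum_eq: "X \<subseteq> V \<Longrightarrow> degree_sum = inside X + 2 * cross X"
  unfolding degree_sum_def degree_def inside_eq cross_def
  using sum_pairs_bipartition[of X adj] adj_sym by simp

lemma inside_degree_le:
  assumes X: "X \<subseteq> V" and u: "u \<in> X"
  shows "2 * (\<Sum>v\<in>X. adj u v) \<le> inside X"
proof -
  have fX: "finite X" using X finite_V by (rule finite_subset)
  have "2 * (\<Sum>v\<in>X. adj u v) = 2 * (\<Sum>v\<in>X-{u}. adj u v)"
    using u fX by (simp add: sum.remove[of X u] adj_irrefl)
  also have "\<dots> \<le> (\<Sum>v\<in>X. adj u v) + (\<Sum>w\<in>X-{u}. adj w u)"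
    using u fX by (simp add: sum.remove[of X u] adj_irrefl adj_sym)
  also have "\<dots> \<le> (\<Sum>v\<in>X. adj u v) + (\<Sum>w\<in>X-{u}. \<Sum>v\<in>X. adj w v)"
    using u fX by (intro add_left_mono sum_mono member_le_sum adj_nonneg)
  also have "\<dots> = (\<Sum>w\<in>X. \<Sum>v\<in>X. adj w v)"
    using u fX by (simp add: sum.remove[of X u])
  also have "\<dots> \<le> inside X"
    unfolding inside_eq[OF X] by (simp add: sum_nonneg adj_nonneg)
  finally show ?thesis .
qed

lemma inside_compl: "X \<subseteq> V \<Longrightarrow> inside (V - X) = inside X"
  unfolding inside_def by (intro sum.cong refl) auto

lemma cross_le: "X \<subseteq> V \<Longrightarrow> cross X \<le> card X * card (V - X)"
proof -
  have "cross X \<le> (\<Sum>u\<in>X. \<Sum>v\<in>V - X. 1)"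
    unfolding cross_def by (intro sum_mono adj_le_1)
  then show ?thesis by simp
qed

lemma inside_int: "inside X \<in> \<int>" and cross_int: "cross X \<in> \<int>"
proof -
  have "adj u v \<in> \<int>" for u v using adj_01[of u v] by auto
  then show "inside X \<in> \<int>" "cross X \<in> \<int>"
    unfolding inside_def cross_def by (auto intro!: Ints_sum)
qed

text \<open>
  The pairs missing between \<open>{u, v}\<close> and the opposite part are among the
  \<open>card X * card (V - X) - cross X\<close> missing crossing pairs.
\<close>

lemma codegree_ge:
  assumes X: "X \<subseteq> V" and uv: "u \<in> X" "v \<in> X" "u \<noteq> v"
  shows "card (V - X) - (card X * card (V - X) - cross X) \<le> (\<Sum>w\<in>V - X. adj u w * adj v w)"
proof -
  have fX: "finite X" using X finite_V by (rule finite_subset)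
  have "(\<Sum>w\<in>V - X. (1 - adj u w)) + (\<Sum>w\<in>V - X. (1 - adj v w)) = (\<Sum>z\<in>{u,v}. \<Sum>w\<in>V - X. (1 - adj z w))"
    using uv by simp
  also have "\<dots> \<le> (\<Sum>z\<in>X. \<Sum>w\<in>V - X. (1 - adj z w))"
    using uv fX by (intro sum_mono2) (auto intro!: sum_nonneg simp: adj_le_1)
  also have "\<dots> = card X * card (V - X) - cross X"
    by (simp add: cross_def sum_subtractf)
  finally have *: "(\<Sum>w\<in>V - X. (1 - adj u w)) + (\<Sum>w\<in>V - X. (1 - adj v w)) \<le> card X * card (V - X) - cross X" .
  have "(\<Sum>w\<in>V - X. 1 - (1 - adj u w) - (1 - adj v w)) \<le> (\<Sum>w\<in>V - X. adj u w * adj v w)"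
  proof (intro sum_mono)
    fix w show "1 - (1 - adj u w) - (1 - adj v w) \<le> adj u w * adj v w"
      using adj_01[of u w] adj_01[of v w] by auto
  qed
  moreover have "(\<Sum>w\<in>V - X. 1 - (1 - adj u w) - (1 - adj v w))
     = card (V - X) - (\<Sum>w\<in>V - X. (1 - adj u w)) - (\<Sum>w\<in>V - X. (1 - adj v w))"
    by (simp add: sum_subtractf sum.distrib)
  ultimately show ?thesis using * by linarith
qed

text \<open>
  A triangle that consists of an inside edge and a vertex of the opposite part has exactly one
  inside edge. In an ordered triple that edge may occupy any of three pairs of positions, which by
  symmetry contribute the same sum \<open>Z\<close>; each inside edge has at least \<open>c\<close> common neighbours across.
\<close>

lemma triples_ge_inside:
  assumes X: "X \<subseteq> V"
    and c: "c \<le> card X - (card X * card (V - X) - cross X)"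
           "c \<le> card (V - X) - (card X * card (V - X) - cross X)"
  shows "3 * inside X * c \<le> triples"
proof -
  \<comment> \<open>\<open>S u v * (1 - S u w)\<close> selects the triples in which \<open>u\<close> and \<open>v\<close> share a part and \<open>w\<close> lies in the other.\<close>
  define S where "S u v = (if u \<in> X \<longleftrightarrow> v \<in> X then 1 else 0 :: real)" for u v
  define t where "t u v w = adj u v * adj u w * adj v w" for u v w
  have t0: "0 \<le> t u v w" for u v w unfolding t_def by (intro mult_nonneg_nonneg adj_nonneg)
  have Ssym: "S u v = S v u" for u v by (auto simp: S_def)
  define Z where "Z = (\<Sum>u\<in>V. \<Sum>v\<in>V. \<Sum>w\<in>V. t u v w * (S u v * (1 - S u w)))"
  have VX: "V - (V - X) = X" using X by blast
  have "(\<Sum>w\<in>V. t u v w * (S u v * (1 - S u w))) \<ge> c * (adj u v * S u v)" if uv: "u \<in> V" "v \<in> V" for u v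
  proof (cases "S u v = 0 \<or> adj u v = 0")
    case True
    then show ?thesis by (auto simp: t_def)
  next
    case False
    then have 1: "S u v = 1" "adj u v = 1" using adj_01[of u v] by (auto simp: S_def split: if_splits)
    then have ne: "u \<noteq> v" using adj_irrefl by auto
    have same: "u \<in> X \<longleftrightarrow> v \<in> X" using 1 by (auto simp: S_def split: if_splits)
    have *: "c \<le> (\<Sum>w\<in>V - Y. adj u w * adj v w) \<and> (\<Sum>w\<in>V. t u v w * (S u v * (1 - S u w))) = (\<Sum>w\<in>V - Y. adj u w * adj v w)"
      if Y: "Y = X \<or> Y = V - X" and uY: "u \<in> Y" "v \<in> Y" for Y
    proof
      have YV: "Y \<subseteq> V" using Y X by blast
      show "c \<le> (\<Sum>w\<in>V - Y. adj u w * adj v w)"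
        using codegree_ge[OF YV uY ne] Y c cross_compl[OF X] by (auto simp: VX mult.commute)
      have "(\<Sum>w\<in>V. t u v w * (S u v * (1 - S u w))) = (\<Sum>w\<in>V - Y. t u v w * (S u v * (1 - S u w)))"
        using Y uY X by (intro sum.mono_neutral_right finite_V) (auto simp: S_def)
      also have "\<dots> = (\<Sum>w\<in>V - Y. adj u w * adj v w)"
        using Y uY X 1 by (intro sum.cong) (auto simp: S_def t_def)
      finally show "(\<Sum>w\<in>V. t u v w * (S u v * (1 - S u w))) = (\<Sum>w\<in>V - Y. adj u w * adj v w)" .
    qed
    show ?thesis
      using *[of X] *[of "V - X"] same uv 1 by (cases "u \<in> X") auto
  qed
  then have "(\<Sum>u\<in>V. \<Sum>v\<in>V. c * (adj u v * S u v)) \<le> Z"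
    unfolding Z_def by (intro sum_mono) auto
  moreover have "(\<Sum>u\<in>V. \<Sum>v\<in>V. c * (adj u v * S u v)) = c * inside X"
    unfolding inside_def sum_distrib_left by (intro sum.cong refl) (simp add: S_def)
  ultimately have Zge: "c * inside X \<le> Z" by simp
  have Z2: "(\<Sum>u\<in>V. \<Sum>v\<in>V. \<Sum>w\<in>V. t u v w * (S u w * (1 - S u v))) = Z"
    unfolding Z_def
    by (rule sum.cong[OF refl], subst sum.swap, intro sum.cong refl) (simp add: t_def adj_sym mult_ac)
  have Z3: "(\<Sum>u\<in>V. \<Sum>v\<in>V. \<Sum>w\<in>V. t u v w * (S v w * (1 - S u v))) = Z"
  proof -
    have "(\<Sum>u\<in>V. \<Sum>v\<in>V. \<Sum>w\<in>V. t u v w * (S v w * (1 - S u v)))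
        = (\<Sum>v\<in>V. \<Sum>u\<in>V. \<Sum>w\<in>V. t u v w * (S v w * (1 - S u v)))" by (rule sum.swap)
    also have "\<dots> = (\<Sum>v\<in>V. \<Sum>u\<in>V. \<Sum>w\<in>V. t v u w * (S v w * (1 - S v u)))"
      by (intro sum.cong refl) (simp add: t_def adj_sym Ssym mult_ac)
    finally show ?thesis unfolding Z2 .
  qed
  have "3 * Z = (\<Sum>u\<in>V. \<Sum>v\<in>V. \<Sum>w\<in>V. t u v w * (S u v * (1 - S u w)) + t u v w * (S u w * (1 - S u v))
      + t u v w * (S v w * (1 - S u v)))"
    unfolding sum.distrib Z2 Z3 by (simp add: Z_def)
  also have "\<dots> \<le> (\<Sum>u\<in>V. \<Sum>v\<in>V. \<Sum>w\<in>V. t u v w)"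
  proof (intro sum_mono)
    fix u v w
    have "S u v * (1 - S u w) + S u w * (1 - S u v) + S v w * (1 - S u v) \<le> 1"
      by (auto simp: S_def)
    from mult_left_mono[OF this t0, of u v w]
    show "t u v w * (S u v * (1 - S u w)) + t u v w * (S u w * (1 - S u v))
      + t u v w * (S v w * (1 - S u v)) \<le> t u v w" by (simp add: algebra_simps)
  qed
  also have "\<dots> = triples" by (simp add: triples_def t_def)
  finally show ?thesis using Zge by (simp add: mult_ac)
qed

section \<open>Entries of the Perron vector\<close>

text \<open>
  The crossing edges form a matrix of Frobenius norm \<open>sqrt (cross X)\<close>, so the Cauchy-Schwarz
  inequality bounds their share by the weights \<open>p\<close> and \<open>1 - p\<close> of the parts; for the few
  inside edges the largest entry of \<open>x\<close> suffices.
\<close>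

lemma quad_cross_bound:
  assumes X: "X \<subseteq> V" and x1: "(\<Sum>v\<in>V. (x v)\<^sup>2) = 1"
    and x0: "\<And>v. 0 \<le> x v" and xb: "\<And>v. v \<in> V \<Longrightarrow> x v \<le> \<beta>"
  defines "p \<equiv> (\<Sum>v\<in>X. (x v)\<^sup>2)"
  shows "quad x \<le> sqrt (cross X) * (2 * sqrt (p * (1 - p))) + inside X * \<beta>\<^sup>2"
proof -
  have p2: "(\<Sum>v\<in>V - X. (x v)\<^sup>2) = 1 - p"
    using sum.subset_diff[OF X finite_V, of "\<lambda>v. (x v)\<^sup>2"] x1 by (simp add: p_def)
  have q: "quad x = ((\<Sum>u\<in>X. \<Sum>v\<in>X. adj u v * x u * x v) + (\<Sum>u\<in>V-X. \<Sum>v\<in>V-X. adj u v * x u * x v))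
     + 2 * (\<Sum>u\<in>X. \<Sum>v\<in>V-X. adj u v * x u * x v)"
    unfolding quad_def by (rule sum_pairs_bipartition[OF X]) (simp add: adj_sym mult_ac)
  have le: "adj u v * x u * x v \<le> adj u v * \<beta>\<^sup>2" if "u \<in> V" "v \<in> V" for u v
  proof -
    have "x u * x v \<le> \<beta> * \<beta>" using xb[OF that(1)] xb[OF that(2)] x0[of v] x0[of u] by (intro mult_mono) auto
    from mult_left_mono[OF this adj_nonneg[of u v]] show ?thesis by (simp add: power2_eq_square mult_ac)
  qed
  have "(\<Sum>u\<in>X. \<Sum>v\<in>X. adj u v * x u * x v) + (\<Sum>u\<in>V-X. \<Sum>v\<in>V-X. adj u v * x u * x v)
     \<le> (\<Sum>u\<in>X. \<Sum>v\<in>X. adj u v * \<beta>\<^sup>2) + (\<Sum>u\<in>V-X. \<Sum>v\<in>V-X. adj u v * \<beta>\<^sup>2)"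
    using X by (intro add_mono sum_mono le) auto
  also have "\<dots> = inside X * \<beta>\<^sup>2"
    unfolding inside_eq[OF X] by (simp add: sum_distrib_right distrib_right)
  finally have ins: "(\<Sum>u\<in>X. \<Sum>v\<in>X. adj u v * x u * x v) + (\<Sum>u\<in>V-X. \<Sum>v\<in>V-X. adj u v * x u * x v)
     \<le> inside X * \<beta>\<^sup>2" .
  have "(\<Sum>u\<in>X. \<Sum>v\<in>V-X. adj u v * x u * x v)\<^sup>2
     = (\<Sum>e\<in>X \<times> (V - X). adj (fst e) (snd e) * (x (fst e) * x (snd e)))\<^sup>2"
    by (simp add: sum.cartesian_product case_prod_beta mult_ac)
  also have "\<dots> \<le> (\<Sum>e\<in>X \<times> (V - X). (adj (fst e) (snd e))\<^sup>2) * (\<Sum>e\<in>X \<times> (V - X). (x (fst e) * x (snd e))\<^sup>2)"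
    by (rule Cauchy_Schwarz_ineq_sum)
  also have "(\<Sum>e\<in>X \<times> (V - X). (x (fst e) * x (snd e))\<^sup>2) = p * (1 - p)"
    unfolding p2[symmetric] unfolding p_def sum_product
    by (simp add: sum.cartesian_product case_prod_beta power_mult_distrib)
  also have "(\<Sum>e\<in>X \<times> (V - X). (adj (fst e) (snd e))\<^sup>2) = cross X"
    unfolding cross_def adj_square by (simp add: sum.cartesian_product case_prod_beta)
  finally have "(\<Sum>u\<in>X. \<Sum>v\<in>V-X. adj u v * x u * x v) \<le> sqrt (cross X * (p * (1 - p)))"
    by (rule real_le_rsqrt)
  then show ?thesis using ins unfolding q real_sqrt_mult by simp
qed

lemma eigenvector_entry_crude:
  assumes eig: "(\<Sum>w\<in>V. adj u w * x w) = r * x u" and x1: "(\<Sum>v\<in>V. (x v)\<^sup>2) = 1"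
  shows "(r * x u)\<^sup>2 \<le> card V"
proof -
  have "(r * x u)\<^sup>2 \<le> (\<Sum>w\<in>V. (adj u w)\<^sup>2) * (\<Sum>w\<in>V. (x w)\<^sup>2)"
    unfolding eig[symmetric] by (rule Cauchy_Schwarz_ineq_sum)
  also have "\<dots> \<le> (\<Sum>w\<in>V. 1)"
    unfolding x1 adj_square by (simp add: sum_bounded_above[of V "adj u" 1, simplified] adj_le_1)
  finally show ?thesis by simp
qed

text \<open>
  The neighbours of a vertex \<open>u\<close> carrying the largest entry lie in the opposite part, up to at most
  \<open>inside X / 2\<close> of them. Using only the weight of the opposite part, instead of the total weight as in
  \<open>eigenvector_entry_crude\<close>, gains the factor \<open>2\<close> in \<open>(x u)\<^sup>2\<close> that the final estimate relies on.
\<close>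

lemma eigenvector_entry_side:
  fixes x :: "'v \<Rightarrow> real"
  assumes X: "X \<subseteq> V" and u: "u \<in> X" and eig: "(\<Sum>w\<in>V. adj u w * x w) = r * x u"
    and x0: "\<And>v. 0 \<le> x v" and max: "\<And>v. v \<in> V \<Longrightarrow> x v \<le> x u"
  shows "r * x u \<le> sqrt (card (V - X) * (\<Sum>v\<in>V - X. (x v)\<^sup>2)) + inside X / 2 * x u"
proof -
  have "r * x u = (\<Sum>w\<in>V - X. adj u w * x w) + (\<Sum>w\<in>X. adj u w * x w)"
    unfolding eig[symmetric] by (rule sum.subset_diff[OF X finite_V])
  moreover have "(\<Sum>w\<in>V - X. adj u w * x w) \<le> (\<Sum>w\<in>V - X. x w)"
    by (intro sum_mono mult_left_le_one_le x0 adj_nonneg adj_le_1)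
  moreover have "(\<Sum>w\<in>V - X. x w) \<le> sqrt (card (V - X) * (\<Sum>v\<in>V - X. (x v)\<^sup>2))"
    using sum_squared_le_sum_of_squares[of x "V - X"] by (intro real_le_rsqrt) (simp add: mult.commute)
  moreover have "(\<Sum>w\<in>X. adj u w * x w) \<le> (\<Sum>w\<in>X. adj u w) * x u"
    unfolding sum_distrib_right using X max by (intro sum_mono mult_left_mono adj_nonneg) auto
  moreover have "(\<Sum>w\<in>X. adj u w) * x u \<le> inside X / 2 * x u"
    using inside_degree_le[OF X u] x0 by (intro mult_right_mono) auto
  ultimately show ?thesis by linarith
qed

end

section \<open>Spectral radius and triangles of a graph\<close>

definition arc_indicator :: "'a pair_pre_digraph \<Rightarrow> 'a \<Rightarrow> 'a \<Rightarrow> real" where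
  "arc_indicator G u v = (if (u, v) \<in> parcs G then 1 else 0)"

lemma adjacency_function_arc_indicator:
  assumes "pair_graph G" "pverts G \<noteq> {}"
  shows "adjacency_function (pverts G) (arc_indicator G)"
proof -
  interpret pair_graph G by fact
  show ?thesis
  proof
    show "arc_indicator G u v = arc_indicator G v u" for u v
      using arcs_symmetric by (auto simp: arc_indicator_def)
    show "arc_indicator G u u = 0" for u
    proof -
      have "(u, u) \<notin> parcs G" using no_loops[of "(u, u)"] by auto
      then show ?thesis by (simp add: arc_indicator_def)
    qed
  qed (use assms in \<open>auto simp: arc_indicator_def\<close>)
qed

text \<open>
  The Rayleigh bound in \<open>perron_pair\<close> applies to every eigenvector, so no eigenvalue exceeds \<open>r\<close>.
\<close>

lemma perron_pair_spectral_radius: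
  assumes G: "pair_graph G" "pverts G \<noteq> {}"
    and pp: "adjacency_function.perron_pair (pverts G) (arc_indicator G) r x"
  shows "graph_spectral_radius G = r"
proof -
  interpret adjacency_function "pverts G" "arc_indicator G"
    by (rule adjacency_function_arc_indicator[OF G])
  let ?A = "adjacency_matrix G (vertex_enum G)"
  have ev: "k \<in> spectrum ?A \<longleftrightarrow> (\<exists>x. (\<exists>v\<in>pverts G. x v \<noteq> 0) \<and>
      (\<forall>v\<in>pverts G. (\<Sum>w\<in>pverts G. arc_indicator G v w * x w) = k * x v))" for k
    unfolding spectrum_def arc_indicator_def
    using eigenvalue_adjacency_matrix_iff[OF bij_betw_vertex_enum[OF finite_V], of k] by simp
  have fin: "finite (spectrum ?A)"
    by (rule card_finite_spectrum(1)[of _ "card (pverts G)"]) (simp add: adjacency_matrix_def)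
  have x: "(\<Sum>v\<in>pverts G. (x v)\<^sup>2) = 1" "\<forall>v\<in>pverts G. (\<Sum>w\<in>pverts G. arc_indicator G v w * x w) = r * x v"
    and ray: "\<And>z. quad z \<le> r * (\<Sum>v\<in>pverts G. (z v)\<^sup>2)"
    using pp unfolding perron_pair_def by blast+
  have "\<exists>v\<in>pverts G. x v \<noteq> 0"
  proof (rule ccontr)
    assume "\<not> ?thesis"
    then have "(\<Sum>v\<in>pverts G. (x v)\<^sup>2) = 0" by simp
    with x(1) show False by simp
  qed
  with x(2) have r: "r \<in> spectrum ?A" unfolding ev by blast
  have le: "k \<le> r" if k: "k \<in> spectrum ?A" for k
  proof -
    from k obtain z where z: "\<exists>v\<in>pverts G. z v \<noteq> 0"
      "\<forall>v\<in>pverts G. (\<Sum>w\<in>pverts G. arc_indicator G v w * z w) = k * z v" unfolding ev by blast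
    have pos: "0 < (\<Sum>v\<in>pverts G. (z v)\<^sup>2)"
      using z(1) finite_V by (auto intro: sum_pos2)
    have "quad z = (\<Sum>v\<in>pverts G. z v * (\<Sum>w\<in>pverts G. arc_indicator G v w * z w))"
      by (simp add: quad_def sum_distrib_left mult_ac)
    also have "\<dots> = k * (\<Sum>v\<in>pverts G. (z v)\<^sup>2)"
      using z(2) by (simp add: sum_distrib_left power2_eq_square mult_ac)
    finally show ?thesis using ray[of z] pos by simp
  qed
  show ?thesis unfolding graph_spectral_radius_def
    by (rule Max_eqI[OF fin le r])
qed

text \<open>
  Each triangle is listed in six orders; the triples are matched with the permutations of the triangles.
\<close>

lemma ordered_triples_eq_triangles:
  assumes "pair_graph G" "pverts G \<noteq> {}"
  shows "adjacency_function.triples (pverts G) (arc_indicator G) = 6 * card (triangles G)"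
proof -
  interpret adjacency_function "pverts G" "arc_indicator G"
    by (rule adjacency_function_arc_indicator[OF assms])
  let ?V = "pverts G"
  have sym: "(u, v) \<in> parcs G \<longleftrightarrow> (v, u) \<in> parcs G" for u v
    using adj_sym[of u v] by (auto simp: arc_indicator_def split: if_splits)
  have irr: "(u, u) \<notin> parcs G" for u
    using adj_irrefl[of u] by (auto simp: arc_indicator_def split: if_splits)
  define P where "P = {(u, v, w). u \<in> ?V \<and> v \<in> ?V \<and> w \<in> ?V \<and> (u, v) \<in> parcs G \<and> (u, w) \<in> parcs G \<and> (v, w) \<in> parcs G}"
  have subs: "P \<subseteq> ?V \<times> ?V \<times> ?V" by (auto simp: P_def)
  have "triples = (\<Sum>e\<in>?V \<times> ?V \<times> ?V. if e \<in> P then 1 else 0)"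
    unfolding triples_def sum.cartesian_product
    by (rule sum.cong[OF refl]) (clarsimp simp: P_def arc_indicator_def)
  also have "\<dots> = card P"
    using subs finite_V by (simp add: sum.If_cases Int_absorb1)
  finally have triples: "triples = card P" .
  have finT: "finite (triangles G)" by (rule finite_subset[of _ "Pow ?V"]) (auto simp: triangles_def finite_V)
  have bij: "bij_betw (\<lambda>(u, v, w). [u, v, w]) P (\<Union>T\<in>triangles G. permutations_of_set T)"
  proof (rule bij_betw_imageI)
    show "inj_on (\<lambda>(u, v, w). [u, v, w]) P" by (auto simp: inj_on_def)
    show "(\<lambda>(u, v, w). [u, v, w]) ` P = (\<Union>T\<in>triangles G. permutations_of_set T)"
    proof (intro equalityI subsetI)
      fix l assume "l \<in> (\<lambda>(u, v, w). [u, v, w]) ` P"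
      then obtain u v w where l: "l = [u, v, w]" and P: "(u, v, w) \<in> P" by auto
      have ne: "u \<noteq> v" "u \<noteq> w" "v \<noteq> w" using P irr by (auto simp: P_def)
      have "{u, v, w} \<in> triangles G"
        using P ne sym[of u v] sym[of u w] sym[of v w] by (auto simp: triangles_def P_def)
      moreover have "l \<in> permutations_of_set {u, v, w}"
        using ne by (auto simp: permutations_of_set_def l)
      ultimately show "l \<in> (\<Union>T\<in>triangles G. permutations_of_set T)" by blast
    next
      fix l assume "l \<in> (\<Union>T\<in>triangles G. permutations_of_set T)"
      then obtain T where T: "T \<in> triangles G" "set l = T" "distinct l"
        by (auto simp: permutations_of_set_def)
      then have "length l = 3" using distinct_card[of l] by (simp add: triangles_def)
      then obtain u v w where l: "l = [u, v, w]"
        by (auto simp: numeral_3_eq_3 length_Suc_conv)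
      have "(u, v, w) \<in> P" using T unfolding l by (auto simp: triangles_def P_def)
      then show "l \<in> (\<lambda>(u, v, w). [u, v, w]) ` P" unfolding l by force
    qed
  qed
  have "card P = card (\<Union>T\<in>triangles G. permutations_of_set T)" by (rule bij_betw_same_card[OF bij])
  also have "\<dots> = (\<Sum>T\<in>triangles G. card (permutations_of_set T))"
    by (rule card_UN_disjoint[OF finT]) (simp, auto simp: permutations_of_set_def)
  also have "\<dots> = (\<Sum>T\<in>triangles G. 6)"
  proof (intro sum.cong refl)
    fix T assume "T \<in> triangles G"
    then have "card T = 3" by (simp add: triangles_def)
    moreover from this have "finite T" using card.infinite by fastforce
    ultimately show "card (permutations_of_set T) = 6" by (simp add: fact_numeral)
  qed
  finally show ?thesis unfolding triples by simp
qed

text \<open>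
  The test vector with value \<open>sqrt b\<close> on the large part and \<open>sqrt a\<close> on the small one is the
  Perron vector of the Turan graph, where it gives \<open>sqrt (a b)\<close>; each matching edge adds \<open>2 b\<close> to the
  form, whose normalisation is \<open>2 a b\<close>. For odd \<open>n\<close>, and \<open>q\<close> small
  compared with \<open>n\<close>, the all-ones vector gives a weaker bound.
\<close>

lemma spectral_radius_Y_graph_ge:
  assumes q: "2 * q \<le> (n + 1) div 2" and n: "2 \<le> n"
  defines "a \<equiv> (n + 1) div 2" and "b \<equiv> n div 2"
  shows "sqrt (real a * real b) + real q / real a \<le> graph_spectral_radius (Y_graph n q)"
proof -
  have ab: "a + b = n" "0 < a" "0 < b" using n unfolding a_def b_def by auto
  have V: "pverts (Y_graph n q) = {..<n}" by (simp add: Y_graph_def turan_bipartite_def)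
  have G: "pair_graph (Y_graph n q)" "pverts (Y_graph n q) \<noteq> {}"
    using pair_graph_Y_graph[OF q] n unfolding V by (auto simp: lessThan_empty_iff)
  interpret adjacency_function "pverts (Y_graph n q)" "arc_indicator (Y_graph n q)"
    by (rule adjacency_function_arc_indicator[OF G])
  obtain r x where pp: "perron_pair r x" using ex_perron_pair by blast
  have ray: "quad z \<le> r * (\<Sum>v\<in>{..<n}. (z v)\<^sup>2)" for z
  proof -
    have "quad z \<le> r * (\<Sum>v\<in>pverts (Y_graph n q). (z v)\<^sup>2)"
      using pp unfolding perron_pair_def by blast
    then show ?thesis by (simp only: V)
  qed
  define z where "z i = (if i < a then sqrt b else sqrt a)" for i :: nat
  have V2: "{..<n} = {..<a} \<union> {a..<n}" using ab by auto
  have "(\<Sum>v\<in>{..<n}. (z v)\<^sup>2) = (\<Sum>v\<in>{..<a}. (z v)\<^sup>2) + (\<Sum>v\<in>{a..<n}. (z v)\<^sup>2)"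
    unfolding V2 by (rule sum.union_disjoint) auto
  also have "\<dots> = 2 * (real a * real b)"
    using ab by (simp add: z_def)
  finally have norm: "(\<Sum>v\<in>{..<n}. (z v)\<^sup>2) = 2 * (real a * real b)" .
  let ?M = "(\<lambda>i. (2 * i, 2 * i + 1)) ` {..<q} :: (nat \<times> nat) set"
  let ?M' = "(\<lambda>i. (2 * i + 1, 2 * i)) ` {..<q} :: (nat \<times> nat) set"
  let ?C = "{..<a} \<times> {a..<n}" and ?C' = "{a..<n} \<times> {..<a}"
  have arcs: "parcs (Y_graph n q) = ?C \<union> ?C' \<union> (?M \<union> ?M')"
    by (auto simp: Y_graph_def turan_bipartite_def a_def)
  have qa: "2 * q \<le> a" using q a_def by simp
  let ?g = "\<lambda>(u, v). z u * z v"
  have sub: "parcs (Y_graph n q) \<subseteq> {..<n} \<times> {..<n}" unfolding arcs using qa ab by auto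
  have "quad z = (\<Sum>e\<in>{..<n} \<times> {..<n}. if e \<in> parcs (Y_graph n q) then ?g e else 0)"
    unfolding quad_def unfolding V sum.cartesian_product
    by (intro sum.cong refl) (auto simp: arc_indicator_def)
  also have "\<dots> = sum ?g (parcs (Y_graph n q))"
    using sub by (simp add: sum.If_cases Int_absorb1)
  also have "\<dots> = sum ?g (?C \<union> ?C') + sum ?g (?M \<union> ?M')"
    unfolding arcs using qa by (intro sum.union_disjoint) auto
  also have "sum ?g (?C \<union> ?C') = sum ?g ?C + sum ?g ?C'"
    by (intro sum.union_disjoint) auto
  also have "sum ?g (?M \<union> ?M') = sum ?g ?M + sum ?g ?M'"
    by (intro sum.union_disjoint) auto
  also have "sum ?g ?M = (\<Sum>i<q. z (2 * i) * z (2 * i + 1))"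
    by (subst sum.reindex) (auto simp: inj_on_def)
  also have "\<dots> = (\<Sum>i<q. real b)"
    using qa by (intro sum.cong refl) (auto simp: z_def)
  also have "sum ?g ?M' = (\<Sum>i<q. z (2 * i + 1) * z (2 * i))"
    by (subst sum.reindex) (auto simp: inj_on_def)
  also have "\<dots> = (\<Sum>i<q. real b)"
    using qa by (intro sum.cong refl) (auto simp: z_def)
  also have "sum ?g ?C = (\<Sum>e\<in>?C. sqrt (real a * real b))"
    by (intro sum.cong refl) (auto simp: z_def real_sqrt_mult)
  also have "sum ?g ?C' = (\<Sum>e\<in>?C'. sqrt (real a * real b))"
    by (intro sum.cong refl) (auto simp: z_def real_sqrt_mult)
  finally have "quad z = 2 * (real a * real b) * sqrt (real a * real b) + 2 * real q * real b"
    using ab(2,3) by (simp add: card_cartesian_product ab(1)[symmetric] algebra_simps)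
  also have "\<dots> = 2 * (real a * real b) * (sqrt (real a * real b) + real q / real a)"
    using ab by (simp add: field_simps)
  finally have "2 * (real a * real b) * (sqrt (real a * real b) + real q / real a) \<le> 2 * (real a * real b) * r"
    using ray[of z] unfolding norm by (simp add: mult.commute)
  then have "sqrt (real a * real b) + real q / real a \<le> r"
    using ab by (subst (asm) mult_le_cancel_left_pos) auto
  then show ?thesis unfolding perron_pair_spectral_radius[OF G pp] .
qed

section \<open>Numerical estimates\<close>

lemma sqrt_le_tangent:
  fixes t M :: real
  assumes a: "0 \<le> t" "0 < M" "t \<le> M\<^sup>2"
  shows "sqrt t \<le> M - (M\<^sup>2 - t) / (2 * M)"
proof -
  have e: "M - (M\<^sup>2 - t) / (2 * M) = (M\<^sup>2 + t) / (2 * M)" using a by (simp add: field_simps power2_eq_square)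
  have "0 \<le> (M - sqrt t)\<^sup>2" by simp
  then have "2 * M * sqrt t \<le> M\<^sup>2 + t" using a by (simp add: power2_diff)
  then show ?thesis unfolding e using a by (simp add: field_simps)
qed

text \<open>
  The edge number \<open>D / 2\<close> falls short of \<open>a b\<close> by at most \<open>q\<close>: the radius alone would give an excess
  of about \<open>2 q\<close>, and the triangles take back less than \<open>3 q\<close>.
\<close>

lemma degree_sum_bound:
  fixes a b N q r T D :: real
  assumes N: "N\<^sup>2 = a * b" "0 < N" "N \<le> a" "0 < b" and q: "0 \<le> q"
    and r: "N + q / a \<le> r" and tr: "2 * r ^ 3 \<le> T + r * D" and T: "T < 6 * q * b"
  shows "2 * N\<^sup>2 - 2 * q \<le> D"
proof -
  have a: "0 < a" using N by linarith
  have rN: "N \<le> r" using r q a by (smt (verit) divide_nonneg_pos)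
  then have r0: "0 < r" using N by linarith
  have "N\<^sup>2 + 2 * (q * N / a) \<le> (N + q / a)\<^sup>2"
    by (simp add: power2_sum algebra_simps)
  also have "\<dots> \<le> r\<^sup>2" using r q a N by (intro power_mono) auto
  finally have r2: "N\<^sup>2 + 2 * (q * N / a) \<le> r\<^sup>2" .
  have "2 * r\<^sup>2 \<le> T / r + D"
    using tr r0 by (simp add: field_simps power2_eq_square power3_eq_cube)
  moreover have "T / r \<le> 6 * q * b / N"
  proof -
    have "T / r \<le> 6 * q * b / r" using T r0 by (simp add: divide_right_mono)
    also have "\<dots> \<le> 6 * q * b / N" using rN N q by (intro divide_left_mono) auto
    finally show ?thesis .
  qed
  moreover have "6 * q * b / N = 6 * (q * N / a)"
    using N a by (simp add: field_simps power2_eq_square)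
  moreover have "q * N / a \<le> q" using N a q by (simp add: divide_le_eq mult_left_mono)
  moreover define Z where "Z = q * N / a"
  ultimately show ?thesis using r2 unfolding Z_def[symmetric] by linarith
qed

text \<open>
  The neighbourhood bipartition has at most \<open>4 q\<close> inside edges (\<open>I\<close> counts them twice): the edge
  deficit accounts for \<open>q\<close> of them and the triangles for \<open>3 q\<close>, up to a rounding error below \<open>1\<close>.
\<close>

lemma inside_bound:
  fixes n b N q T D I :: real
  assumes n: "0 < n" "2 * b \<le> n" "n\<^sup>2 - 1 \<le> 4 * N\<^sup>2" and q: "0 \<le> q"
    and D: "2 * N\<^sup>2 - 2 * q \<le> D" and T: "T < 6 * q * b"
    and I: "n * I \<le> n * D - 2 * D\<^sup>2 / n + 2 * T"
  shows "I < 8 * q + 1"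
proof -
  \<comment> \<open>Dropping \<open>- e\<^sup>2\<close> below makes a distinction by the sign of \<open>e\<close> unnecessary.\<close>
  define e where "e = n\<^sup>2 - 2 * D"
  have e: "e \<le> 4 * q + 1" using n D unfolding e_def by linarith
  have "n * D - 2 * D\<^sup>2 / n = (n\<^sup>2 - e) * e / (2 * n)"
    using n unfolding e_def by (simp add: field_simps power2_eq_square)
  also have "\<dots> \<le> n\<^sup>2 * e / (2 * n)"
    using n by (intro divide_right_mono) (auto simp: algebra_simps)
  also have "\<dots> = n * e / 2" using n by (simp add: power2_eq_square)
  also have "\<dots> \<le> n * (4 * q + 1) / 2" using e n by simp
  finally have "n * I \<le> n * (4 * q + 1) / 2 + 2 * T" using I by linarith
  also have "\<dots> < n * (4 * q + 1) / 2 + 12 * q * b" using T by linarith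
  also have "\<dots> \<le> n * (4 * q + 1) / 2 + 6 * q * n"
    using mult_left_mono[OF n(2) q] by linarith
  also have "\<dots> = n * (8 * q + 1 / 2)" by (simp add: algebra_simps)
  finally show ?thesis using n by simp
qed

text \<open>
  Were the weights \<open>p\<close> and \<open>1 - p\<close> of the two parts far apart, \<open>2 sqrt (p (1 - p))\<close> would be well below
  \<open>1\<close>, and the crossing edges, which carry almost all of \<open>r\<close>, could not contribute enough.
\<close>

lemma weight_balance:
  fixes p N b q r s I \<beta> :: real
  assumes p: "0 \<le> p" "p \<le> 1" and N: "0 < N" "N \<le> r" "N \<le> b + 1" "60 \<le> b" and q: "1 \<le> q"
    and I: "0 \<le> I" "I \<le> 8 * q" and s: "s \<le> N" and \<beta>: "\<beta>\<^sup>2 \<le> 2 / b"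
    and r: "r \<le> s * (2 * sqrt (p * (1 - p))) + I * \<beta>\<^sup>2"
  shows "\<bar>2 * p - 1\<bar> \<le> 6 * q / N"
proof -
  define c where "c = 2 * sqrt (p * (1 - p))"
  have pp: "0 \<le> p * (1 - p)" using p by simp
  have c0: "0 \<le> c" using p by (simp add: c_def)
  have csq: "c\<^sup>2 = 1 - (2 * p - 1)\<^sup>2"
    using pp by (simp add: c_def power_mult_distrib) (simp add: power2_eq_square algebra_simps)
  then have "c\<^sup>2 \<le> 1\<^sup>2" by simp
  then have c1: "c \<le> 1" by (rule power2_le_imp_le) simp
  have "I * \<beta>\<^sup>2 \<le> (8 * q) * (2 / b)" using I \<beta> N q by (intro mult_mono) auto
  moreover have "s * c \<le> N * c" using s c0 by (intro mult_right_mono)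
  ultimately have "N * (1 - c) \<le> 16 * q / b" using r N unfolding c_def[symmetric] by (simp add: algebra_simps)
  then have "N * (1 - c) / N \<le> 16 * q / b / N" using N by (intro divide_right_mono) auto
  then have "1 - c \<le> 16 * q / b / N" using N by simp
  moreover have "(2 * p - 1)\<^sup>2 \<le> 2 * (1 - c)"
    using csq zero_le_power2[of "1 - c"] by (simp add: power2_diff)
  ultimately have "(2 * p - 1)\<^sup>2 \<le> 2 * (16 * q / b / N)"
    by (meson mult_left_mono order_trans zero_le_numeral)
  also have "\<dots> = 32 * q / (b * N)" by simp
  also have "\<dots> \<le> (6 * q / N)\<^sup>2"
  proof -
    have "b \<le> q * b" using q N by simp
    then have "32 * N \<le> 36 * (q * b)" using N by linarith
    from mult_left_mono[OF this, of q] have "32 * q * N \<le> 36 * q\<^sup>2 * b"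
      using q by (simp add: power2_eq_square algebra_simps)
    then show ?thesis using N by (simp add: field_simps power2_eq_square)
  qed
  finally have "(2 * p - 1)\<^sup>2 \<le> (6 * q / N)\<^sup>2" .
  then have "\<bar>2 * p - 1\<bar> \<le> \<bar>6 * q / N\<bar>" by (simp only: abs_le_square_iff)
  then show ?thesis using N q by simp
qed

text \<open>
  Nearly \<open>a b\<close> crossing pairs are possible only if the parts are nearly balanced.
\<close>

lemma part_size_bound:
  fixes x y a b N q :: real
  assumes xy: "x + y = a + b" "N\<^sup>2 - 5 * q \<le> x * y" and ab: "N\<^sup>2 = a * b" "b \<le> a" "a \<le> b + 1" "b \<le> N"
    and q: "1 \<le> q"
  shows "y \<le> N + 3 * q"
proof -
  have "(y - x)\<^sup>2 = (a + b)\<^sup>2 - 4 * (x * y)"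
    unfolding xy(1)[symmetric] by (simp add: power2_eq_square algebra_simps)
  also have "\<dots> \<le> (a + b)\<^sup>2 - 4 * N\<^sup>2 + 20 * q" using xy by linarith
  also have "\<dots> = (a - b)\<^sup>2 + 20 * q" unfolding ab(1) by (simp add: power2_eq_square algebra_simps)
  also have "\<dots> \<le> 1 + 20 * q"
  proof -
    have "\<bar>a - b\<bar> \<le> 1" using ab by linarith
    then show ?thesis by (simp add: abs_square_le_1)
  qed
  also have "\<dots> \<le> 25 * q" using q by simp
  also have "\<dots> \<le> (5 * q)\<^sup>2" using q by (simp add: power2_eq_square)
  finally have "(y - x)\<^sup>2 \<le> (5 * q)\<^sup>2" .
  then have "y - x \<le> 5 * q" by (rule power2_le_imp_le) (use q in simp)
  then show ?thesis using xy ab q by linarith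
qed

text \<open>
  In a balanced complete bipartite graph, \<open>2 N \<beta>\<^sup>2 = 1\<close>. Three relative errors enter, all of
  order \<open>q / N\<close>: the size \<open>y\<close> of the opposite part, its weight \<open>w\<close>, and the inside neighbours. The
  constant \<open>20\<close> absorbs them and is small enough that \<open>20 * q / N \<le> 1 / (3 q)\<close>, whereas the
  final contradiction needs slightly less than \<open>1 / (2 q)\<close>.
\<close>

lemma entry_bound:
  fixes N q r \<beta> y w I :: real
  assumes q: "1 \<le> q" and N: "60 * q\<^sup>2 \<le> N" "N \<le> r" and \<beta>: "0 \<le> \<beta>"
    and y: "0 \<le> y" "y \<le> N + 3 * q" and w: "0 \<le> w" "w \<le> (1 + 6 * q / N) / 2" and I: "I \<le> 8 * q"
    and r: "r * \<beta> \<le> sqrt (y * w) + I / 2 * \<beta>"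
  shows "2 * N * \<beta>\<^sup>2 \<le> 1 + 20 * q / N"
proof -
  define \<theta> where "\<theta> = q / N"
  have "q \<le> q\<^sup>2" using q by (simp add: power2_eq_square)
  then have qN: "60 * q \<le> N" using N by linarith
  then have N0: "0 < N" using q by linarith
  have th: "0 \<le> \<theta>" "\<theta> \<le> 1 / 60" using q qN N0 by (auto simp: \<theta>_def field_simps)
  have qth: "q = \<theta> * N" using N0 by (simp add: \<theta>_def)
  have "(N - 4 * q) * \<beta> \<le> (r - I / 2) * \<beta>" using N I \<beta> by (intro mult_right_mono) auto
  also have "\<dots> \<le> sqrt (y * w)" using r by (simp add: algebra_simps)
  finally have "((N - 4 * q) * \<beta>)\<^sup>2 \<le> (sqrt (y * w))\<^sup>2"
    using qN q \<beta> by (intro power_mono) auto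
  also have "\<dots> = y * w" using y w by simp
  also have "\<dots> \<le> (N + 3 * q) * ((1 + 6 * q / N) / 2)"
    using y w by (intro mult_mono) auto
  also have "\<dots> = N * ((1 + 3 * \<theta>) * (1 + 6 * \<theta>) / 2)"
    using N0 by (simp add: qth field_simps)
  also have "((N - 4 * q) * \<beta>)\<^sup>2 = N * (N * \<beta>\<^sup>2 * (1 - 4 * \<theta>)\<^sup>2)"
    by (simp add: qth power2_eq_square algebra_simps)
  finally have "2 * N * \<beta>\<^sup>2 * (1 - 4 * \<theta>)\<^sup>2 \<le> (1 + 3 * \<theta>) * (1 + 6 * \<theta>)"
    using N0 by simp
  also have "\<dots> \<le> (1 + 20 * \<theta>) * (1 - 4 * \<theta>)\<^sup>2"
  proof -
    \<comment> \<open>This expression is the right-hand side minus the left-hand side.\<close>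
    have "0 \<le> \<theta> * (3 - 162 * \<theta> + 320 * \<theta>\<^sup>2)"
      using th by (intro mult_nonneg_nonneg) (auto intro!: add_nonneg_nonneg)
    then show ?thesis by (simp add: power2_eq_square algebra_simps)
  qed
  finally have "2 * N * \<beta>\<^sup>2 \<le> 1 + 20 * \<theta>"
    using th by (simp add: mult_le_cancel_right)
  then show ?thesis by (simp add: \<theta>_def)
qed

text \<open>
  Removing \<open>R\<close> of the \<open>N\<^sup>2\<close> crossing edges costs \<open>R / (2 N)\<close> in the radius, while \<open>I / 2\<close> inside
  edges gain about \<open>I / (2 N)\<close>; the net gain must reach \<open>q / a\<close>.
\<close>

lemma edge_deficit_bound:
  fixes N q r a b c R I \<beta> :: real
  assumes q: "1 \<le> q" and N: "0 < N" "N \<le> a" "b \<le> N" "a \<le> b + 1" and R: "0 \<le> R" "R \<le> N\<^sup>2"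
    and r: "N + q / a \<le> r" "r \<le> sqrt (N\<^sup>2 - R) * c + I * \<beta>\<^sup>2" and c: "c \<le> 1"
    and I: "0 \<le> I" and \<beta>: "2 * N * \<beta>\<^sup>2 \<le> 1 + 20 * q / N"
  shows "2 * q + R \<le> I * (1 + 20 * q / N) + 2 * q / N"
proof -
  have a: "0 < a" using N by linarith
  have "sqrt (N\<^sup>2 - R) * c \<le> sqrt (N\<^sup>2 - R) * 1" using c R by (intro mult_left_mono) auto
  also have "\<dots> \<le> N - R / (2 * N)" using sqrt_le_tangent[of "N\<^sup>2 - R" N] N R by simp
  finally have "q / a + R / (2 * N) \<le> I * \<beta>\<^sup>2" using r by linarith
  from mult_left_mono[OF this, of "2 * N"] have "2 * (q * N / a) + R \<le> I * (2 * N * \<beta>\<^sup>2)"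
    using N by (simp add: algebra_simps)
  also have "\<dots> \<le> I * (1 + 20 * q / N)" using I \<beta> by (intro mult_left_mono)
  finally have 1: "2 * (q * N / a) + R \<le> I * (1 + 20 * q / N)" .
  have "q - q / N \<le> q - q / a" using N q a by (simp add: frac_le)
  also have "\<dots> = q * (a - 1) / a" using a by (simp add: field_simps)
  also have "\<dots> \<le> q * N / a" using N q a by (intro divide_right_mono mult_left_mono) auto
  finally show ?thesis using 1 by linarith
qed

text \<open>
  As \<open>q\<^sup>2 / N \<le> 1 / 60\<close>, the error terms in the first inequality are less than \<open>1\<close> when \<open>I \<le> 2 * q\<close>,
  and integrality then excludes \<open>I < 2 * q\<close> and leaves only \<open>R = 0\<close> for \<open>I = 2 * q\<close>. For larger \<open>I\<close>,
  the first inequality allows a deficit \<open>R\<close> of at most three times the excess \<open>k\<close>, whereas the second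
  one, the triangle count, needs \<open>R\<close> to exceed \<open>k * b / I\<close>, where \<open>b / I\<close> is at least \<open>60 / 8\<close>.
\<close>

lemma deficit_contradiction:
  fixes q N b I R :: real
  assumes q: "1 \<le> q" and N: "60 * q\<^sup>2 \<le> b" "b \<le> N"
    and I: "I \<in> \<int>" "R \<in> \<int>" "0 \<le> I" "I \<le> 8 * q" "q \<in> \<int>" "0 \<le> R"
    and 1: "2 * q + R \<le> I * (1 + 20 * q / N) + 2 * q / N"
    and 2: "I * (b - R) < 2 * q * b"
  shows False
proof -
  define \<theta> where "\<theta> = q / N"
  have qq: "q \<le> q\<^sup>2" using q by (simp add: power2_eq_square)
  then have N0: "0 < N" using N q by linarith
  have th: "0 \<le> \<theta>" "\<theta> \<le> 1 / 60" "\<theta> * q \<le> 1 / 60"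
  proof -
    have "60 * q \<le> N" "60 * (q * q) \<le> N" using N qq by (auto simp: power2_eq_square)
    then show "0 \<le> \<theta>" "\<theta> \<le> 1 / 60" "\<theta> * q \<le> 1 / 60"
      using q N0 by (auto simp: \<theta>_def field_simps)
  qed
  define k where "k = I - 2 * q"
  have kZ: "k \<in> \<int>" unfolding k_def using I by auto
  have Rk: "R \<le> k + 20 * (\<theta> * I) + 2 * \<theta>" using 1 by (simp add: k_def \<theta>_def algebra_simps)
  have int_le: "z \<le> -1 \<or> z = 0 \<or> 1 \<le> z" if z: "z \<in> \<int>" for z :: real
  proof -
    obtain i where "z = of_int i" using z by (rule Ints_cases)
    then show ?thesis by (cases "i \<le> -1"; cases "i = 0") auto
  qed
  have thI: "\<theta> * I = 2 * (\<theta> * q) + \<theta> * k" by (simp add: k_def algebra_simps)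
  from int_le[OF kZ] consider "k \<le> -1" | "k = 0" | "1 \<le> k" by blast
  then show False
  proof cases
    case 1
    then have "\<theta> * k \<le> 0" using th by (intro mult_nonneg_nonpos) auto
    then show False using Rk thI th I 1 by linarith
  next
    case 2
    then have "\<theta> * k = 0" by simp
    then have "R < 1" using Rk thI th 2 by linarith
    then have "R = 0" using int_le[OF I(2)] I by linarith
    then show False using assms(11) 2 by (simp add: k_def)
  next
    case 3
    then have "\<theta> * k \<le> 1 / 60 * k" using th by (intro mult_right_mono) auto
    then have R3: "R \<le> 3 * k" using Rk thI th 3 by linarith
    have "k * b < I * R" using assms(11) by (simp add: k_def algebra_simps)
    also have "\<dots> \<le> (8 * q) * (3 * k)" using I R3 q by (intro mult_mono) auto
    finally have "k * b < k * (24 * q)" by (simp add: mult_ac)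
    then have "b < 24 * q" using 3 by simp
    then show False using N qq q by linarith
  qed
qed

section \<open>Counting triangles\<close>

text \<open>
  Shrinking the part of size \<open>b\<close> by \<open>j\<close> vertices loses at least \<open>j\<close> crossing pairs, so the
  deficit of crossing edges compensates for a part that is smaller than \<open>b\<close>.
\<close>

lemma part_sizes_product:
  fixes s t a b :: nat
  assumes st: "s + t = a + b" and ab: "b \<le> a" "a \<le> b + 1"
  shows "real b + real s * real t \<le> real s + real a * real b"
proof -
  define j where "j = int b - int s"
  have t: "int t = int a + j" and s: "int s = int b - j" using st by (auto simp: j_def)
  have "0 \<le> j * j - j * (int b - int a + 1)"
  proof (cases "a = b")
    case True
    have "0 \<le> j * (j - 1)" by (cases "j \<le> 0") (auto intro: mult_nonpos_nonpos mult_nonneg_nonneg)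
    then show ?thesis using True by (simp add: algebra_simps)
  next
    case False
    then have "a = b + 1" using ab by simp
    then show ?thesis by simp
  qed
  then have "int b + int s * int t \<le> int s + int a * int b"
    unfolding s t by (simp add: algebra_simps)
  then have "int (b + s * t) \<le> int (s + a * b)" by simp
  then have "b + s * t \<le> s + a * b" by (simp only: of_nat_le_iff)
  then have "real (b + s * t) \<le> real (s + a * b)" by (simp only: of_nat_le_iff)
  then show ?thesis by simp
qed

context adjacency_function begin

text \<open>
  This is where the estimates are put together, free of matrices and spectra: the spectral radius enters
  only through a Perron pair.
\<close>

lemma triples_ge_of_perron_value:
  fixes a b q :: nat
  assumes n: "card V = a + b" and ab: "b \<le> a" "a \<le> b + 1" and q: "1 \<le> q" "60 * q\<^sup>2 \<le> b"
    and pp: "perron_pair r x" and r: "sqrt (real a * real b) + real q / real a \<le> r"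
  shows "6 * real q * real b \<le> triples"
proof (rule ccontr)
  assume "\<not> ?thesis"
  then have T: "triples < 6 * real q * real b" by simp
  have x0: "\<And>v. 0 \<le> x v" and x1: "(\<Sum>v\<in>V. (x v)\<^sup>2) = 1"
    and eig: "\<And>v. v \<in> V \<Longrightarrow> (\<Sum>w\<in>V. adj v w * x w) = r * x v"
    using pp unfolding perron_pair_def by blast+
  have quadx: "quad x = r" by (rule perron_pair_quad[OF pp])
  define N where "N = sqrt (real a * real b)"
  have q1: "1 \<le> real q" using q by simp
  have q60: "60 * (real q)\<^sup>2 \<le> real b" using q(2) by (metis of_nat_le_iff of_nat_mult of_nat_numeral of_nat_power)
  have "1 \<le> (real q)\<^sup>2" using q1 by simp
  then have b60: "60 \<le> real b" using q60 by linarith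
  have ab': "real b \<le> real a" "real a \<le> real b + 1" using ab by auto
  have N2: "N\<^sup>2 = real a * real b" unfolding N_def by simp
  have Nb: "real b \<le> N" unfolding N_def using ab' by (intro real_le_rsqrt) (simp add: power2_eq_square mult_right_mono)
  have Na: "N \<le> real a" unfolding N_def using ab' by (intro real_le_lsqrt) (auto simp: power2_eq_square mult_left_mono)
  have N0: "0 < N" using Nb b60 by linarith
  have r': "N + real q / real a \<le> r" using r N_def by simp
  have "0 \<le> real q / real a" by simp
  then have rN: "N \<le> r" using r' by linarith
  have D: "2 * N\<^sup>2 - 2 * real q \<le> degree_sum"
    using degree_sum_bound[OF N2 N0 Na _ _ r' trace_cube_bound[OF pp] T] b60 q1 by simp
  have nr: "real (card V) = real a + real b" using n by simp
  obtain X0 where X0: "X0 \<subseteq> V" and "card V * inside X0 \<le> card V * degree_sum - 2 * degree_sum\<^sup>2 / card V + 2 * triples"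
    using ex_neighbourhood_bipartition by blast
  moreover have "(real (card V))\<^sup>2 - 1 \<le> 4 * N\<^sup>2"
  proof -
    have "(real a - real b)\<^sup>2 \<le> 1" using ab' by (simp add: abs_square_le_1)
    then show ?thesis unfolding nr N2 by (simp add: power2_eq_square algebra_simps)
  qed
  ultimately have I0: "inside X0 < 8 * real q + 1"
    using inside_bound[of "real (card V)" "real b" N "real q" degree_sum triples "inside X0"] D T b60 q1 ab' nr
    by simp
  obtain u where u: "u \<in> V" and max: "\<And>v. v \<in> V \<Longrightarrow> x v \<le> x u"
  proof -
    have "Max (x ` V) \<in> x ` V" using finite_V V_nonempty by (intro Max_in) auto
    then obtain u where "u \<in> V" "Max (x ` V) = x u" by blast
    moreover have "x v \<le> Max (x ` V)" if "v \<in> V" for v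
      using finite_V that by (intro Max_ge) auto
    ultimately show ?thesis using that by simp
  qed
  \<comment> \<open>Exchanging the parts if necessary, the largest entry of \<open>x\<close> lies in \<open>X\<close>.\<close>
  define X where "X = (if u \<in> X0 then X0 else V - X0)"
  have X: "X \<subseteq> V" "u \<in> X" using X0 u by (auto simp: X_def)
  have "inside X = inside X0" unfolding X_def using inside_compl[OF X0] by simp
  with I0 have "inside X < 8 * real q + 1" by simp
  moreover obtain i where i: "inside X = of_int i" using inside_int by (rule Ints_cases)
  ultimately have "real_of_int i < real_of_int (8 * int q + 1)" by simp
  then have "i \<le> 8 * int q" by (simp only: of_int_less_iff)
  then have "real_of_int i \<le> real_of_int (8 * int q)" by (simp only: of_int_le_iff)
  then have I: "inside X \<le> 8 * real q" by (simp add: i)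
  have Inn: "0 \<le> inside X" unfolding inside_def by (intro sum_nonneg) (simp add: adj_nonneg)
  have DX: "degree_sum = inside X + 2 * cross X" by (rule degree_sum_eq[OF X(1)])
  have fX: "finite X" using X(1) finite_V by (rule finite_subset)
  have "card X + card (V - X) = card V" using X(1) finite_V fX by (simp add: card_Diff_subset card_mono)
  then have cardsn: "card X + card (V - X) = a + b" using n by simp
  then have cards: "real (card X) + real (card (V - X)) = real a + real b" by (metis of_nat_add)
  have cr: "cross X \<le> real (card X) * real (card (V - X))" using cross_le[OF X(1)] by simp
  have "N\<^sup>2 - 5 * real q \<le> real (card X) * real (card (V - X))" using D DX I cr by linarith
  from part_size_bound[OF cards this N2 ab' Nb q1]
  have ysz: "real (card (V - X)) \<le> N + 3 * real q" .
  have prodr: "real b + real (card X) * real (card (V - X)) \<le> real (card X) + real a * real b"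
    by (rule part_sizes_product[OF cardsn ab])
  have "card (V - X) + card X = a + b" using cardsn by simp
  from part_sizes_product[OF this ab]
  have prodr': "real b + real (card X) * real (card (V - X)) \<le> real (card (V - X)) + real a * real b"
    by (simp only: mult.commute)
  define R where "R = N\<^sup>2 - cross X"
  have "card X \<le> b \<or> card (V - X) \<le> b" using cardsn ab by linarith
  then have "real (card X) \<le> real b \<or> real (card (V - X)) \<le> real b" by (simp only: of_nat_le_iff)
  then have prodle: "real (card X) * real (card (V - X)) \<le> real a * real b"
    using prodr prodr' by linarith
  have R0: "0 \<le> R" unfolding R_def N2 using prodle cr by linarith
  have cross0: "0 \<le> cross X" unfolding cross_def by (intro sum_nonneg adj_nonneg)
  have RN: "R \<le> N\<^sup>2" using cross0 by (simp add: R_def)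
  have RZ: "R \<in> \<int>" unfolding R_def N2 using cross_int by auto
  define p where "p = (\<Sum>v\<in>X. (x v)\<^sup>2)"
  have p2: "(\<Sum>v\<in>V - X. (x v)\<^sup>2) = 1 - p"
    using sum.subset_diff[OF X(1) finite_V, of "\<lambda>v. (x v)\<^sup>2"] x1 by (simp add: p_def)
  have p: "0 \<le> p" "0 \<le> 1 - p" unfolding p2[symmetric] by (auto simp: p_def intro: sum_nonneg)
  have rX: "r \<le> sqrt (cross X) * (2 * sqrt (p * (1 - p))) + inside X * (x u)\<^sup>2"
    using quad_cross_bound[OF X(1) x1 x0 max] unfolding quadx p_def by simp
  have crude: "(x u)\<^sup>2 \<le> 2 / real b"
  proof -
    have "(N * x u)\<^sup>2 \<le> (r * x u)\<^sup>2" using rN N0 x0 by (intro power_mono mult_right_mono) auto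
    also have "\<dots> \<le> card V" by (rule eigenvector_entry_crude[OF eig[OF u] x1])
    also have "\<dots> \<le> 2 * real a" using nr ab' by simp
    finally have "real a * (real b * (x u)\<^sup>2) \<le> real a * 2" by (simp add: power_mult_distrib N2 mult_ac)
    then have "real b * (x u)\<^sup>2 \<le> 2" using Na N0 by simp
    then show ?thesis using b60 by (simp add: field_simps)
  qed
  have sN: "sqrt (cross X) \<le> N" using R0 N0 by (intro real_le_lsqrt) (auto simp: R_def cross0)
  have "N \<le> real b + 1" using Na ab' by linarith
  from weight_balance[OF p(1) _ N0 rN this b60 q1 Inn I sN crude rX] p
  have "\<bar>2 * p - 1\<bar> \<le> 6 * real q / N" by simp
  then have "- (2 * p - 1) \<le> 6 * real q / N" by (rule abs_le_D2)
  then have w: "1 - p \<le> (1 + 6 * real q / N) / 2" by simp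
  have side: "r * x u \<le> sqrt (real (card (V - X)) * (1 - p)) + inside X / 2 * x u"
    using eigenvector_entry_side[OF X eig[OF u] x0 max] unfolding p2 by simp
  have "60 * (real q)\<^sup>2 \<le> N" using q60 Nb by linarith
  from entry_bound[OF q1 this rN x0 _ ysz p(2) w I side]
  have \<beta>: "2 * N * (x u)\<^sup>2 \<le> 1 + 20 * real q / N" by simp
  have c1: "2 * sqrt (p * (1 - p)) \<le> 1"
  proof -
    have "4 * (p * (1 - p)) \<le> 1" using zero_le_power2[of "2 * p - 1"] by (simp add: power2_eq_square algebra_simps)
    then have "sqrt (p * (1 - p)) \<le> 1 / 2" by (intro real_le_lsqrt) (auto simp: power2_eq_square)
    then show ?thesis by simp
  qed
  have "r \<le> sqrt (N\<^sup>2 - R) * (2 * sqrt (p * (1 - p))) + inside X * (x u)\<^sup>2" using rX by (simp add: R_def)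
  from edge_deficit_bound[OF q1 N0 Na Nb ab'(2) R0 RN r' this c1 Inn \<beta>]
  have fin1: "2 * real q + R \<le> inside X * (1 + 20 * real q / N) + 2 * real q / N" .
  have "3 * inside X * (real b - R) \<le> triples"
    by (rule triples_ge_inside[OF X(1)]) (use prodr prodr' N2 in \<open>simp_all add: R_def\<close>)
  then have fin2: "inside X * (real b - R) < 2 * real q * real b" using T by simp
  show False
    by (rule deficit_contradiction[OF q1 q60 Nb inside_int RZ Inn I _ R0 fin1 fin2]) simp
qed

end

theorem theorem2p2:
  fixes n q :: nat and G :: "'a pair_pre_digraph"
  assumes "1 \<le> q" and "real q \<le> 1 / 11 * sqrt (real n)"
    and "pair_graph G" and "card (pverts G) = n"
    and "graph_spectral_radius G \<ge> graph_spectral_radius (Y_graph n q)"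
  shows "card (triangles G) \<ge> q * (n div 2)"
proof -
  have "(11 * real q)\<^sup>2 \<le> (sqrt (real n))\<^sup>2" using assms(2) by (intro power_mono) auto
  then have "real (121 * q\<^sup>2) \<le> real n" by (simp add: power_mult_distrib)
  then have nq: "121 * q\<^sup>2 \<le> n" by (simp only: of_nat_le_iff)
  have qq: "q \<le> q\<^sup>2" using assms(1) by (simp add: power2_eq_square)
  define a where "a = (n + 1) div 2"
  define b where "b = n div 2"
  have ab: "b \<le> a" "a \<le> b + 1" "n = a + b" unfolding a_def b_def by auto
  have bq: "60 * q\<^sup>2 \<le> b" using nq unfolding b_def by linarith
  have G: "pair_graph G" "pverts G \<noteq> {}" using assms nq qq by auto
  interpret adjacency_function "pverts G" "arc_indicator G"
    by (rule adjacency_function_arc_indicator[OF G])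
  obtain r x where pp: "perron_pair r x" using ex_perron_pair by blast
  have "2 * q \<le> (n + 1) div 2" "2 \<le> n" using nq qq assms(1) by linarith+
  from spectral_radius_Y_graph_ge[OF this]
  have "sqrt (real a * real b) + real q / real a \<le> r"
    using assms(5) unfolding perron_pair_spectral_radius[OF G pp] a_def b_def by simp
  from triples_ge_of_perron_value[OF _ ab(1,2) assms(1) bq pp this] assms(4) ab(3)
  have "6 * real q * real b \<le> triples" by simp
  then have "real (q * b) \<le> real (card (triangles G))"
    unfolding ordered_triples_eq_triangles[OF G] by simp
  then show ?thesis unfolding b_def by (simp only: of_nat_le_iff)
qed

end
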